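(* Let $\mathcal{A}$ be a $C^*$-algebra, let $X$ be an inner product $\mathcal{A}$-module and let $x,y,e\in X$. If $\langle e,e\rangle$ is an idempotent in $\mathcal{A}$, then for every $a,b,c,d\in\mathcal{A}$ we have $$|\langle x,y\rangle-\langle x,e\rangle\langle e,y\rangle| \le\left\|x-e\left(\frac{a+b}{2}\right)\right\|\,\left|y-e\left(\frac{c+d}{2}\right)\right|$$ $$=\left\|\frac14|e(a-b)|^2-\mathrm{Re}\langle x-ea,eb-x\rangle\right\|^{1/2}\left(\frac14|e(c-d)|^2-\mathrm{Re}\langle y-ec,ed-y\rangle\right)^{1/2}.$$ Furthermore, if $$\mathrm{Re}\langle x-ea,eb-x\rangle\ge 0\quad\text{and}\quad \mathrm{Re}\langle y-ec,ed-y\rangle\ge 0,$$ then $$|\langle x,y\rangle-\langle x,e\rangle\langle e,y\rangle|\le\frac14\|e(a-b)\|\,|e(c-d)|.$$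
   Context: An inner product module over a $C^*$-algebra $\mathcal{A}$ is a right $\mathcal{A}$-module $X$ (as usual, a complex vector space whose scalar multiplication is compatible with the $\mathcal{A}$-action) with a map $\langle\cdot,\cdot\rangle:X\times X\to\mathcal{A}$ such that (i) $\langle x,y+z\rangle=\langle x,y\rangle+\langle x,z\rangle$; (ii) $\langle x,ya\rangle=\langle x,y\rangle a$; (iii) $\langle x,y\rangle^*=\langle y,x\rangle$; (iv) $\langle x,x\rangle\ge 0$; (v) $\langle x,x\rangle=0$ implies $x=0$, for all $x,y,z\in X$, $a\in\mathcal{A}$. For $x\in X$, $|x|=\langle x,x\rangle^{1/2}\in\mathcal{A}$ and $\|x\|=\|\langle x,x\rangle\|^{1/2}$; for $a\in\mathcal{A}$, $|a|=(a^*a)^{1/2}$ and $\mathrm{Re}\,a=\frac12(a+a^* )$. The order $\le$ is the usual order on self-adjoint elements of $\mathcal{A}$. *)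

theory Defs
  imports "HOL-Analysis.Analysis"
begin

text \<open>C*-algebras are not assumed to be unital.\<close>

class cstar_algebra = real_normed_algebra + banach +
  fixes scaleC :: "complex \<Rightarrow> 'a \<Rightarrow> 'a"  (infixr "*\<^sub>C" 75)
    and adj :: "'a \<Rightarrow> 'a"
  assumes scaleC_add_right: "s *\<^sub>C (a + b) = s *\<^sub>C a + s *\<^sub>C b"
    and scaleC_add_left: "(s + t) *\<^sub>C a = s *\<^sub>C a + t *\<^sub>C a"
    and scaleC_scaleC: "s *\<^sub>C t *\<^sub>C a = (s * t) *\<^sub>C a"
    and scaleC_of_real: "complex_of_real r *\<^sub>C a = r *\<^sub>R a"
    and scaleC_mult_left: "(s *\<^sub>C a) * b = s *\<^sub>C (a * b)"
    and scaleC_mult_right: "a * (s *\<^sub>C b) = s *\<^sub>C (a * b)"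
    and norm_scaleC: "norm (s *\<^sub>C a) = cmod s * norm a"
    and adj_add: "adj (a + b) = adj a + adj b"
    and adj_scaleC: "adj (s *\<^sub>C a) = cnj s *\<^sub>C adj a"
    and adj_mult: "adj (a * b) = adj b * adj a"
    and adj_adj: "adj (adj a) = a"
    and cstar_identity: "norm (adj a * a) = (norm a)\<^sup>2"

text \<open>
  The spectrum is taken in the unitization \<open>A \<oplus> \<complex>\<close>, where the pair \<open>(a, s)\<close> stands for
  \<open>a + s 1\<close>. If \<open>A\<close> already has a unit, this adds at most the point \<open>0\<close> to the spectrum
  relative to \<open>A\<close>, which is irrelevant for positivity.
\<close>

definition unitization_mult ::
    "'a::cstar_algebra \<times> complex \<Rightarrow> 'a \<times> complex \<Rightarrow> 'a \<times> complex" where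
  "unitization_mult u v =
     (fst u * fst v + snd u *\<^sub>C fst v + snd v *\<^sub>C fst u, snd u * snd v)"

definition unitization_invertible :: "'a::cstar_algebra \<times> complex \<Rightarrow> bool" where
  "unitization_invertible u \<longleftrightarrow>
     (\<exists>v. unitization_mult u v = (0, 1) \<and> unitization_mult v u = (0, 1))"

definition spectrum :: "'a::cstar_algebra \<Rightarrow> complex set" where
  "spectrum a = {s. \<not> unitization_invertible (- a, s)}"

definition self_adjoint :: "'a::cstar_algebra \<Rightarrow> bool" where
  "self_adjoint a \<longleftrightarrow> adj a = a"

definition positive :: "'a::cstar_algebra \<Rightarrow> bool" where
  "positive a \<longleftrightarrow> self_adjoint a \<and> spectrum a \<subseteq> \<real>\<^sub>\<ge>\<^sub>0"

definition cstar_le :: "'a::cstar_algebra \<Rightarrow> 'a \<Rightarrow> bool"  (infix "\<preceq>" 50) where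
  "a \<preceq> b \<longleftrightarrow> self_adjoint a \<and> self_adjoint b \<and> positive (b - a)"

text \<open>Only meaningful for positive arguments, which have exactly one positive square root.\<close>

definition pos_sqrt :: "'a::cstar_algebra \<Rightarrow> 'a" where
  "pos_sqrt a = (THE b. positive b \<and> b * b = a)"

definition cstar_abs :: "'a::cstar_algebra \<Rightarrow> 'a" where
  "cstar_abs a = pos_sqrt (adj a * a)"

definition real_part :: "'a::cstar_algebra \<Rightarrow> 'a" where
  "real_part a = (1/2) *\<^sub>R (a + adj a)"

text \<open>
  Compatibility of the complex scalars of the module with the inner product need not be
  assumed: \<open>ip x (s y) a = ip x ((s y) a) = ip x (y (s a)) = s (ip x y) a\<close> for all \<open>a\<close>,
  and an element annihilated by right multiplication with its own adjoint is \<open>0\<close>.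
\<close>

locale inner_product_module = vector_space smul
  for smul :: "complex \<Rightarrow> 'x::ab_group_add \<Rightarrow> 'x" +
  fixes act :: "'x \<Rightarrow> 'a::cstar_algebra \<Rightarrow> 'x"  (infixl "\<cdot>" 70)
    and ip :: "'x \<Rightarrow> 'x \<Rightarrow> 'a"
  assumes act_add_left: "(x + y) \<cdot> a = x \<cdot> a + y \<cdot> a"
    and act_add_right: "x \<cdot> (a + b) = x \<cdot> a + x \<cdot> b"
    and act_mult: "x \<cdot> (a * b) = x \<cdot> a \<cdot> b"
    and act_smul: "smul s x \<cdot> a = smul s (x \<cdot> a)"
    and act_scaleC: "x \<cdot> (s *\<^sub>C a) = smul s (x \<cdot> a)"
    and ip_add_right: "ip x (y + z) = ip x y + ip x z"
    and ip_act_right: "ip x (y \<cdot> a) = ip x y * a"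
    and adj_ip: "adj (ip x y) = ip y x"
    and ip_self_nonneg: "0 \<preceq> ip x x"
    and ip_self_eq_0: "ip x x = 0 \<Longrightarrow> x = 0"

definition module_abs :: "('x \<Rightarrow> 'x \<Rightarrow> 'a::cstar_algebra) \<Rightarrow> 'x \<Rightarrow> 'a" where
  "module_abs ip x = pos_sqrt (ip x x)"

definition module_norm :: "('x \<Rightarrow> 'x \<Rightarrow> 'a::cstar_algebra) \<Rightarrow> 'x \<Rightarrow> real" where
  "module_norm ip x = sqrt (norm (ip x x))"

end

theory Submission
  imports Defs
begin

text \<open>
  Put \<open>p = \<langle>e,e\<rangle>\<close>. If \<open>p\<close> is idempotent then \<open>e p = e\<close>, so \<open>x \<mapsto> x - e\<langle>e,x\<rangle>\<close> is an orthogonal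
  projection which kills every \<open>e s\<close>. Hence \<open>\<langle>x,y\<rangle> - \<langle>x,e\<rangle>\<langle>e,y\<rangle>\<close> does not change when
  \<open>x\<close> and \<open>y\<close> are replaced by \<open>x - e s\<close> and \<open>y - e t\<close>, and it equals the inner product of the
  projection of \<open>x - e s\<close> with \<open>y - e t\<close>. The Cauchy-Schwarz inequality
  \<open>\<bar>\<langle>u,v\<rangle>\<bar> \<le> \<parallel>u\<parallel> \<bar>v\<bar>\<close> bounds it (\<open>covariance_le\<close>), since projecting does not increase the
  norm. For the midpoint \<open>s = (a + b)/2\<close> the parallelogram law, applied to \<open>x - e a\<close> and
  \<open>x - e b\<close>, computes \<open>\<langle>x - e s, x - e s\<rangle>\<close> (\<open>ip_midpoint\<close>); this gives the equality, and also
  the last bound, because the square root and the norm are monotone on positive elements.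
  
  The C*-algebra facts behind this are: positive elements form a cone, have unique positive
  square roots, \<open>a\<^sup>* a\<close> is positive, and the square root and the norm are monotone. They are
  proved here without Gelfand theory or the spectral radius formula. In a unital C*-algebra
  let \<open>P\<close> be the set of squares of self-adjoint elements (\<open>pos_cone\<close>). The binomial series of
  \<open>sqrt (1 - c)\<close> converges for \<open>\<parallel>c\<parallel> \<le> 1\<close>, and this yields the metric description
  \<open>a \<in> P \<longleftrightarrow> \<parallel>r - a\<parallel> \<le> r\<close> for self-adjoint \<open>a\<close> and any \<open>r \<ge> \<parallel>a\<parallel>\<close> (\<open>pos_cone_iff\<close>), from which
  \<open>P\<close> is a closed convex cone. The link to the spectrum is \<open>pos_coneI_invertible\<close>: a
  self-adjoint \<open>h\<close> such that \<open>t + h\<close> is invertible for all \<open>t > 0\<close> lies in \<open>P\<close>. Indeed an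
  invertible element of \<open>P\<close> stays in \<open>P\<close> after subtracting a small multiple of the unit, so the
  least \<open>t \<ge> 0\<close> with \<open>t + h \<in> P\<close> must be \<open>0\<close>. Monotonicity of the square root and positivity of
  \<open>a\<^sup>* a\<close> then reduce to the invertibility of explicit elements. Finally, any C*-algebra, with
  or without unit, embeds isometrically into its unitization, which is again a C*-algebra, and
  its positive elements are those that land in \<open>P\<close> (\<open>positive_iff\<close>).
\<close>

section \<open>The involution of a C*-algebra\<close>

lemma adj_0 [simp]: "adj (0::'a::cstar_algebra) = 0"
  using adj_add[of "0::'a" 0] by simp

lemma adj_minus [simp]: "adj (- a) = - adj (a::'a::cstar_algebra)"
  using adj_add[of a "- a"] by (simp add: eq_neg_iff_add_eq_0 add.commute)

lemma adj_diff: "adj (a - b) = adj a - adj (b::'a::cstar_algebra)"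
  using adj_add[of a "- b"] by simp

lemma adj_scaleR [simp]: "adj (r *\<^sub>R a) = r *\<^sub>R adj (a::'a::cstar_algebra)"
  by (metis adj_scaleC complex_cnj_complex_of_real scaleC_of_real)

lemma scaleC_0_right [simp]: "s *\<^sub>C (0::'a::cstar_algebra) = 0"
  using scaleC_add_right[of s "0::'a" 0] by simp

lemma scaleC_minus_right: "s *\<^sub>C (- a) = - (s *\<^sub>C (a::'a::cstar_algebra))"
  using scaleC_add_right[of s a "- a"] by (simp add: eq_neg_iff_add_eq_0 add.commute)

lemma scaleC_diff_right: "s *\<^sub>C (a - b) = s *\<^sub>C a - s *\<^sub>C (b::'a::cstar_algebra)"
  using scaleC_add_right[of s a "- b"] by (simp add: scaleC_minus_right)

lemma scaleC_0_left [simp]: "0 *\<^sub>C (a::'a::cstar_algebra) = 0"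
  using scaleC_of_real[of 0 a] by simp

lemma scaleC_1_left [simp]: "1 *\<^sub>C (a::'a::cstar_algebra) = a"
  using scaleC_of_real[of 1 a] by simp

lemma scaleC_minus_left: "(- s) *\<^sub>C (a::'a::cstar_algebra) = - (s *\<^sub>C a)"
  using scaleC_add_left[of s "- s" a] by (simp add: eq_neg_iff_add_eq_0 add.commute)

lemma scaleR_scaleC: "r *\<^sub>R (s *\<^sub>C a) = s *\<^sub>C (r *\<^sub>R (a::'a::cstar_algebra))"
  by (metis mult.commute scaleC_of_real scaleC_scaleC)

lemma norm_adj [simp]: "norm (adj a) = norm (a::'a::cstar_algebra)"
proof -
  have le: "norm b \<le> norm (adj b)" for b :: 'a
  proof (cases "b = 0")
    case False
    have "norm b * norm b \<le> norm (adj b) * norm b"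
      using cstar_identity[of b] norm_mult_ineq[of "adj b" b] by (simp add: power2_eq_square)
    with False show ?thesis by simp
  qed simp
  show ?thesis using le[of a] le[of "adj a"] by (simp add: adj_adj)
qed

lemma bounded_linear_adj: "bounded_linear (adj :: 'a::cstar_algebra \<Rightarrow> 'a)"
  by (rule bounded_linear_intro[where K = 1]) (simp_all add: adj_add)

lemma adj_mult_self_eq_0: "adj a * a = 0 \<Longrightarrow> a = (0::'a::cstar_algebra)"
  using cstar_identity[of a] by simp

lemma sa_square_eq_0: "adj a = a \<Longrightarrow> a * a = 0 \<Longrightarrow> a = (0::'a::cstar_algebra)"
  using adj_mult_self_eq_0[of a] by simp

section \<open>Unital C*-algebras\<close>

class unital_cstar_algebra = cstar_algebra + real_normed_algebra_1

lemma adj_1 [simp]: "adj (1::'a::unital_cstar_algebra) = 1"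
  by (metis adj_adj adj_mult mult.left_neutral mult.right_neutral)

lemma adj_power: "adj (a ^ n) = adj (a::'a::unital_cstar_algebra) ^ n"
  by (induction n) (simp_all add: adj_mult power_commutes)

section \<open>Invertible elements\<close>

definition has_inverse :: "'a::monoid_mult \<Rightarrow> bool" where
  "has_inverse a \<longleftrightarrow> (\<exists>b. a * b = 1 \<and> b * a = 1)"

lemma has_inverse_mult: "has_inverse a \<Longrightarrow> has_inverse b \<Longrightarrow> has_inverse (a * b)"
  unfolding has_inverse_def
proof (elim exE conjE)
  fix a' b' assume "a * a' = 1" "a' * a = 1" "b * b' = 1" "b' * b = 1"
  then have "a * b * (b' * a') = 1" "b' * a' * (a * b) = 1"
    by (metis mult.assoc mult_1_right)+
  then show "\<exists>c. a * b * c = 1 \<and> c * (a * b) = 1" by blast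
qed

text \<open>
  In a noncommutative ring an invertible product need not have invertible factors (the
  unilateral shift \<open>S\<close> satisfies \<open>S\<^sup>* S = 1\<close>). It does if the factors commute, or if one of them
  is already known to be invertible.
\<close>

lemma has_inverse_left_factor:
  assumes "has_inverse (a * b)" "a * b = b * a"
  shows "has_inverse a"
proof -
  obtain c where c: "a * b * c = 1" "c * (a * b) = 1"
    using assms(1) by (auto simp: has_inverse_def)
  have r: "a * (b * c) = 1" using c(1) by (simp only: mult.assoc)
  have l: "(c * b) * a = 1" using c(2) assms(2) by (simp only: mult.assoc)
  have "c * b = (c * b) * (a * (b * c))" by (simp only: r mult_1_right)
  also have "\<dots> = b * c" using l by (simp only: mult.assoc[symmetric] mult_1_left)
  finally show ?thesis unfolding has_inverse_def using l r by (intro exI[of _ "b * c"]) simp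
qed

lemma has_inverse_cancel_left:
  assumes "has_inverse (a * b)" "has_inverse a"
  shows "has_inverse b"
proof -
  obtain a' where a': "a * a' = 1" "a' * a = 1" using assms(2) by (auto simp: has_inverse_def)
  then have "has_inverse (a' * (a * b))"
    by (intro has_inverse_mult assms(1)) (auto simp: has_inverse_def)
  then show ?thesis using a' by (simp flip: mult.assoc)
qed

lemma has_inverse_scaleR:
  "r \<noteq> 0 \<Longrightarrow> has_inverse a \<Longrightarrow> has_inverse (r *\<^sub>R (a::'a::real_algebra_1))"
  unfolding has_inverse_def
  by (elim exE, rule_tac x = "(1 / r) *\<^sub>R b" in exI) simp

lemma inverse_commutes:
  assumes "a * b = 1" "b * a = (1::'a::monoid_mult)" "a * d = d * a"
  shows "b * d = d * b"
proof -
  have "b * d = b * d * (a * b)" using assms(1) by simp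
  also have "\<dots> = b * (a * d) * b" by (simp add: assms(3) mult.assoc)
  also have "\<dots> = d * b" using assms(2) by (simp flip: mult.assoc)
  finally show ?thesis .
qed

lemma has_inverse_one_minus:
  fixes c :: "'a::unital_cstar_algebra"
  assumes "norm c < 1"
  shows "has_inverse (1 - c)"
proof -
  let ?s = "\<Sum>n. c ^ n"
  have sm: "summable (\<lambda>n. c ^ n)" by (rule complete_algebra_summable_geometric[OF assms])
  have e: "(\<Sum>n. c ^ Suc n) = ?s - 1" using suminf_split_head[OF sm] by simp
  have "c * ?s = ?s - 1"
    using bounded_linear.suminf[OF bounded_linear_mult_right sm, of c] e by simp
  moreover have "?s * c = ?s - 1"
    using bounded_linear.suminf[OF bounded_linear_mult_left sm, of c] e
    by (simp add: power_commutes)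
  ultimately show ?thesis unfolding has_inverse_def
    by (intro exI[of _ ?s]) (simp add: algebra_simps)
qed

section \<open>The binomial series for the square root\<close>

text \<open>
  The Taylor coefficients of \<open>sqrt (1 - z)\<close>. All but the first are nonpositive and their
  partial sums stay nonnegative, so the series converges absolutely on the closed unit ball,
  boundary included. That the radius \<open>1\<close> itself is allowed matters: for \<open>a\<close> in the cone,
  \<open>1 - a / \<parallel>a\<parallel>\<close> can have norm exactly \<open>1\<close>.
\<close>

definition sqrt_coeff :: "nat \<Rightarrow> real" where
  "sqrt_coeff n = pochhammer (-1/2) n / fact n"

lemma sqrt_coeff_0 [simp]: "sqrt_coeff 0 = 1"
  by (simp add: sqrt_coeff_def)

lemma sqrt_coeff_Suc_nonpos: "sqrt_coeff (Suc n) \<le> 0"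
proof -
  have "pochhammer (1/2::real) n \<ge> 0" by (rule pochhammer_nonneg) simp
  then show ?thesis
    by (simp add: sqrt_coeff_def pochhammer_rec divide_nonpos_nonneg)
qed

lemma sum_sqrt_coeff: "(\<Sum>k\<le>n. sqrt_coeff k) = pochhammer (1/2) n / fact n"
proof (induction n)
  case (Suc n)
  have "sqrt_coeff (Suc n) = (-1/2) * (pochhammer (1/2) n / fact n) / (real n + 1)"
    by (simp add: sqrt_coeff_def pochhammer_rec field_simps)
  moreover have "pochhammer (1/2::real) (Suc n) / fact (Suc n) =
      (1/2 + real n) * (pochhammer (1/2) n / fact n) / (real n + 1)"
    by (simp add: pochhammer_Suc field_simps)
  moreover have "u + (-1/2) * u / (real n + 1) = (1/2 + real n) * u / (real n + 1)" for u :: real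
    by (simp add: divide_simps) (simp add: algebra_simps)
  ultimately show ?case using Suc by (simp only: sum.atMost_Suc)
qed (simp add: sqrt_coeff_def)

lemma sqrt_coeff_tail_le: "(\<Sum>k<n. \<bar>sqrt_coeff (Suc k)\<bar>) \<le> 1"
proof -
  have "(\<Sum>k<n. \<bar>sqrt_coeff (Suc k)\<bar>) = - (\<Sum>k<n. sqrt_coeff (Suc k))"
    using sqrt_coeff_Suc_nonpos by (simp add: abs_of_nonpos sum_negf)
  also have "\<dots> = 1 - (\<Sum>k\<le>n. sqrt_coeff k)"
    by (simp add: sum.atMost_shift)
  also have "\<dots> \<le> 1"
    by (simp add: sum_sqrt_coeff pochhammer_nonneg)
  finally show ?thesis .
qed

lemma summable_sqrt_coeff_Suc: "summable (\<lambda>n. \<bar>sqrt_coeff (Suc n)\<bar>)"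
  by (rule bounded_imp_summable[where B = 1])
    (use sqrt_coeff_tail_le[of "Suc _"] in \<open>auto simp: lessThan_Suc_atMost\<close>)

lemma suminf_sqrt_coeff_Suc_le: "(\<Sum>n. \<bar>sqrt_coeff (Suc n)\<bar>) \<le> 1"
  by (rule suminf_le_const[OF summable_sqrt_coeff_Suc sqrt_coeff_tail_le])

text \<open>
  The Chu-Vandermonde identity, expressing that the scalar series squares to \<open>1 - z\<close>.
\<close>

lemma sqrt_coeff_convolution:
  "(\<Sum>k\<le>n. sqrt_coeff k * sqrt_coeff (n - k)) = (if n = 0 then 1 else if n = 1 then -1 else 0)"
proof -
  have "(\<Sum>k\<le>n. sqrt_coeff k * sqrt_coeff (n - k)) =
      (\<Sum>k\<le>n. of_nat (n choose k) * pochhammer (-1/2) k * pochhammer (-1/2) (n - k)) / fact n"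
    unfolding sum_divide_distrib
    by (rule sum.cong) (auto simp: sqrt_coeff_def binomial_fact)
  also have "\<dots> = pochhammer (-1) n / fact n"
    using pochhammer_binomial_sum[of "-1/2::real" "-1/2" n] by simp
  also have "\<dots> = (if n = 0 then 1 else if n = 1 then -1 else 0)"
  proof (cases "n \<le> 1")
    case False
    then have "pochhammer (-1::real) n = 0"
      using pochhammer_of_nat_eq_0_lemma[of 1 n, where 'a = real] by simp
    with False show ?thesis by simp
  qed (auto simp: le_Suc_eq)
  finally show ?thesis .
qed

definition sqrt_one_minus :: "'a::unital_cstar_algebra \<Rightarrow> 'a" where
  "sqrt_one_minus c = (\<Sum>n. sqrt_coeff n *\<^sub>R c ^ n)"

lemma norm_sqrt_term_le:
  fixes c :: "'a::unital_cstar_algebra"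
  assumes "norm c \<le> 1"
  shows "norm (sqrt_coeff n *\<^sub>R c ^ n) \<le> \<bar>sqrt_coeff n\<bar>"
proof -
  have "norm (c ^ n) \<le> 1"
    using norm_power_ineq[of c n] power_le_one[of "norm c" n] assms by simp
  then show ?thesis by (simp add: mult_left_le)
qed

lemma summable_norm_sqrt_series:
  fixes c :: "'a::unital_cstar_algebra"
  assumes "norm c \<le> 1"
  shows "summable (\<lambda>n. norm (sqrt_coeff n *\<^sub>R c ^ n))"
proof (rule summable_comparison_test')
  show "summable (\<lambda>n. \<bar>sqrt_coeff n\<bar>)"
    using summable_sqrt_coeff_Suc by (rule summable_Suc_iff[of "\<lambda>n. \<bar>sqrt_coeff n\<bar>", THEN iffD1])
qed (use norm_sqrt_term_le[OF assms] in auto)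

lemmas summable_sqrt_series = summable_norm_cancel[OF summable_norm_sqrt_series]

lemma sqrt_one_minus_square:
  fixes c :: "'a::unital_cstar_algebra"
  assumes "norm c \<le> 1"
  shows "sqrt_one_minus c * sqrt_one_minus c = 1 - c"
proof -
  let ?f = "\<lambda>n. sqrt_coeff n *\<^sub>R c ^ n"
  have "(\<lambda>n. \<Sum>i\<le>n. ?f i * ?f (n - i)) sums (sqrt_one_minus c * sqrt_one_minus c)"
    unfolding sqrt_one_minus_def
    by (rule Cauchy_product_sums; rule summable_norm_sqrt_series[OF assms])
  moreover have "(\<Sum>i\<le>n. ?f i * ?f (n - i)) = (if n = 0 then 1 else if n = 1 then - c else 0)" for n
  proof -
    have "(\<Sum>i\<le>n. ?f i * ?f (n - i)) = (\<Sum>i\<le>n. sqrt_coeff i * sqrt_coeff (n - i)) *\<^sub>R c ^ n"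
      unfolding scaleR_left.sum by (rule sum.cong) (auto simp flip: power_add)
    then show ?thesis by (simp add: sqrt_coeff_convolution)
  qed
  moreover have "(\<lambda>n. if n = 0 then 1 else if n = 1 then - c else 0) sums (1 - c)"
    using sums_finite[of "{0,1::nat}" "\<lambda>n. if n = 0 then 1 else if n = 1 then - c else 0"] by simp
  ultimately show ?thesis by (simp only: sums_unique2)
qed

text \<open>
  Being a norm limit of real polynomials in \<open>c\<close>, the root commutes with everything that
  commutes with \<open>c\<close> and inherits self-adjointness.
\<close>

lemma sqrt_one_minus_commutes:
  fixes c :: "'a::unital_cstar_algebra"
  assumes "norm c \<le> 1" "c * d = d * c"
  shows "sqrt_one_minus c * d = d * sqrt_one_minus c"
proof -
  have "c ^ n * d = d * c ^ n" for n using assms(2) by (rule power_commuting_commutes)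
  then show ?thesis
    unfolding sqrt_one_minus_def
      bounded_linear.suminf[OF bounded_linear_mult_right summable_sqrt_series[OF assms(1)]]
      bounded_linear.suminf[OF bounded_linear_mult_left summable_sqrt_series[OF assms(1)]]
    by simp
qed

lemma adj_sqrt_one_minus:
  fixes c :: "'a::unital_cstar_algebra"
  assumes "norm c \<le> 1" "adj c = c"
  shows "adj (sqrt_one_minus c) = sqrt_one_minus c"
  unfolding sqrt_one_minus_def
    bounded_linear.suminf[OF bounded_linear_adj summable_sqrt_series[OF assms(1)]]
  by (simp add: adj_power assms)

text \<open>
  This is what will make the root itself positive: an element within distance \<open>1\<close> of the
  unit has a further square root by the same series.
\<close>

lemma norm_one_minus_sqrt_one_minus:
  fixes c :: "'a::unital_cstar_algebra"
  assumes "norm c \<le> 1"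
  shows "norm (1 - sqrt_one_minus c) \<le> 1"
proof -
  let ?f = "\<lambda>n. sqrt_coeff n *\<^sub>R c ^ n"
  have "(\<Sum>n. ?f (Suc n)) = sqrt_one_minus c - 1"
    unfolding sqrt_one_minus_def using suminf_split_head[OF summable_sqrt_series[OF assms]] by simp
  moreover have "norm (\<Sum>n. ?f (Suc n)) \<le> (\<Sum>n. \<bar>sqrt_coeff (Suc n)\<bar>)"
    by (rule norm_suminf_le[OF norm_sqrt_term_le[OF assms] summable_sqrt_coeff_Suc])
  ultimately show ?thesis
    using suminf_sqrt_coeff_Suc_le by (simp add: norm_minus_commute)
qed

section \<open>The cone of squares\<close>

definition pos_cone :: "'a::unital_cstar_algebra set" where
  "pos_cone = {b * b |b. adj b = b}"

lemma pos_coneI: "adj b = b \<Longrightarrow> b * b \<in> pos_cone"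
  by (auto simp: pos_cone_def)

lemma pos_cone_sa: "a \<in> pos_cone \<Longrightarrow> adj a = a"
  by (auto simp: pos_cone_def adj_mult)

lemma zero_in_pos_cone [simp]: "0 \<in> pos_cone"
  using pos_coneI[of 0] by simp

lemma pos_cone_scaleR:
  assumes "a \<in> pos_cone" "0 \<le> r"
  shows "r *\<^sub>R a \<in> pos_cone"
proof -
  obtain b where b: "adj b = b" "a = b * b" using assms(1) by (auto simp: pos_cone_def)
  have "r *\<^sub>R a = (sqrt r *\<^sub>R b) * (sqrt r *\<^sub>R b)" using b assms(2) by simp
  then show ?thesis using b(1) pos_coneI[of "sqrt r *\<^sub>R b"] by simp
qed

lemma pos_cone_scaleR_1: "0 \<le> r \<Longrightarrow> r *\<^sub>R 1 \<in> pos_cone"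
  using pos_cone_scaleR[of 1 r] pos_coneI[of 1] by simp

text \<open>
  For commuting self-adjoint \<open>b\<close> and \<open>k\<close>, the element \<open>m = b + i k\<close> satisfies
  \<open>m\<^sup>* m = b\<^sup>2 + k\<^sup>2\<close>, and \<open>b\<close> is its real part; so the C*-identity alone gives the inequality.
  It replaces the functional calculus in what follows.
\<close>

lemma norm_sa_square_le:
  fixes b k :: "'a::unital_cstar_algebra"
  assumes "adj b = b" "adj k = k" "b * k = k * b"
  shows "(norm b)\<^sup>2 \<le> norm (b * b + k * k)"
proof -
  define m where "m = b + \<i> *\<^sub>C k"
  have am: "adj m = b - \<i> *\<^sub>C k"
    by (simp add: m_def adj_add adj_scaleC assms scaleC_minus_left)
  have "adj m * m = b * b + k * k"
    unfolding am unfolding m_def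
    by (simp add: algebra_simps scaleC_mult_left scaleC_mult_right scaleC_scaleC scaleC_minus_left
        scaleC_diff_right assms(3))
  then have nm: "norm (b * b + k * k) = (norm m)\<^sup>2" by (metis cstar_identity)
  have "2 *\<^sub>R b = m + adj m" unfolding am unfolding m_def by (simp add: scaleR_2)
  then have "2 * norm b \<le> 2 * norm m"
    using norm_triangle_ineq[of m "adj m"] by (metis norm_adj norm_scaleR abs_numeral mult_2)
  then show ?thesis unfolding nm by (simp add: power_mono)
qed

text \<open>
  Write \<open>a = r (1 - c)\<close> with \<open>\<parallel>c\<parallel> \<le> 1\<close> and take \<open>sqrt r\<close> times the series. The resulting root
  is a nonnegative multiple of an element within distance \<open>1\<close> of the unit, so the same
  construction applies to it and shows that it is a square again.
\<close>

lemma sa_sqrt_exists: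
  fixes a :: "'a::unital_cstar_algebra"
  assumes sa: "adj a = a" and near: "norm (r *\<^sub>R 1 - a) \<le> r"
  obtains s where "s \<in> pos_cone" "s * s = a" "\<And>d. a * d = d * a \<Longrightarrow> s * d = d * s"
proof -
  \<comment> \<open>the last conjunct records the shape of \<open>s\<close> to which the construction applies a second time\<close>
  have main: "\<exists>s. adj s = s \<and> s * s = a \<and> (\<forall>d. a * d = d * a \<longrightarrow> s * d = d * s) \<and>
      (\<exists>t\<ge>0. \<exists>k. s = t *\<^sub>R k \<and> norm (1 - k) \<le> 1)"
    if sa: "adj a = a" and near: "norm (r *\<^sub>R 1 - a) \<le> r" for a :: 'a and r
  proof (cases "r = 0")
    case True
    have "\<exists>k. (0::'a) = 0 *\<^sub>R k \<and> norm (1 - k) \<le> 1"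
      by (intro exI[of _ 1]) simp
    then have "\<exists>t\<ge>0. \<exists>k. (0::'a) = t *\<^sub>R k \<and> norm (1 - k) \<le> 1" by blast
    with True near show ?thesis by (intro exI[of _ "0::'a"]) simp
  next
    case False
    have r: "r > 0" using False order_trans[OF norm_ge_zero near] by simp
    define c where "c = 1 - (1 / r) *\<^sub>R a"
    have "c = (1 / r) *\<^sub>R (r *\<^sub>R 1 - a)" using r by (simp add: c_def algebra_simps)
    then have c: "norm c \<le> 1" using near r by simp
    have sc: "adj c = c" by (simp add: c_def adj_diff sa)
    have comm: "c * d = d * c" if "a * d = d * a" for d using that by (simp add: c_def algebra_simps)
    let ?s = "sqrt r *\<^sub>R sqrt_one_minus c"
    have "?s * ?s = r *\<^sub>R (1 - c)" using r by (simp add: sqrt_one_minus_square[OF c])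
    then have "?s * ?s = a" using r by (simp add: c_def)
    moreover have "\<exists>t\<ge>0. \<exists>k. ?s = t *\<^sub>R k \<and> norm (1 - k) \<le> 1"
      using r norm_one_minus_sqrt_one_minus[OF c]
      by (intro exI[of _ "sqrt r"] exI[of _ "sqrt_one_minus c"] conjI) simp_all
    moreover have "adj ?s = ?s" using adj_sqrt_one_minus[OF c sc] by simp
    moreover have "?s * d = d * ?s" if "a * d = d * a" for d
      using sqrt_one_minus_commutes[OF c comm[OF that]] by simp
    ultimately show ?thesis by blast
  qed
  from main[OF sa near] obtain s t k where s: "adj s = s" "s * s = a"
    and comm: "\<forall>d. a * d = d * a \<longrightarrow> s * d = d * s"
    and k: "t \<ge> 0" "s = t *\<^sub>R k" "norm (1 - k) \<le> 1"
    by (elim exE conjE)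
  have "s \<in> pos_cone"
  proof (cases "t = 0")
    case False
    then have sak: "adj k = k" using s(1) k(2) by simp
    have nk: "norm (1 *\<^sub>R 1 - k) \<le> 1" using k(3) by simp
    from main[OF sak nk] obtain l where "adj l = l" "l * l = k" by (elim exE conjE)
    then have "k \<in> pos_cone" using pos_coneI by metis
    then show ?thesis unfolding k(2) using pos_cone_scaleR k(1) by metis
  qed (simp add: k)
  then show thesis by (rule that[OF _ s(2)]) (use comm in blast)
qed

text \<open>
  Membership in the cone is a norm condition. If \<open>d = b\<^sup>2 / r\<close> has norm at most \<open>1\<close>, then
  \<open>1 - d = k\<^sup>2\<close> with \<open>k\<close> commuting with \<open>b\<close>, so \<open>\<parallel>1 - d\<parallel> \<le> \<parallel>k\<parallel>\<^sup>2 \<le> \<parallel>k\<^sup>2 + d\<parallel> = 1\<close>; the converse is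
  the existence of square roots. That the cone is convex and closed becomes the triangle
  inequality and continuity of the norm.
\<close>

lemma pos_cone_iff:
  fixes a :: "'a::unital_cstar_algebra"
  assumes sa: "adj a = a" and r: "norm a \<le> r"
  shows "a \<in> pos_cone \<longleftrightarrow> norm (r *\<^sub>R 1 - a) \<le> r"
proof
  assume "norm (r *\<^sub>R 1 - a) \<le> r"
  then obtain s where "s \<in> pos_cone" "s * s = a" by (rule sa_sqrt_exists[OF sa])
  then show "a \<in> pos_cone" using pos_coneI[OF pos_cone_sa[of s]] by simp
next
  assume "a \<in> pos_cone"
  then obtain b where b: "adj b = b" "a = b * b" by (auto simp: pos_cone_def)
  show "norm (r *\<^sub>R 1 - a) \<le> r"
  proof (cases "r = 0")
    case False
    have r0: "r > 0" using False order_trans[OF norm_ge_zero r] by simp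
    define d where "d = (1 / r) *\<^sub>R a"
    have d: "norm d \<le> 1" "adj d = d" using r r0 sa by (simp_all add: d_def)
    define k where "k = sqrt_one_minus d"
    define b' where "b' = (1 / sqrt r) *\<^sub>R b"
    have "d * b' = b' * d" by (simp add: d_def b'_def b(2) mult.assoc)
    then have "k * b' = b' * k" unfolding k_def by (rule sqrt_one_minus_commutes[OF d(1)])
    moreover have "adj b' = b'" by (simp add: b'_def b(1))
    moreover have "adj k = k" unfolding k_def by (rule adj_sqrt_one_minus[OF d])
    ultimately have "(norm k)\<^sup>2 \<le> norm (k * k + b' * b')" by (intro norm_sa_square_le)
    also have "b' * b' = d" using r0 by (simp add: b'_def d_def b(2))
    also have "k * k + d = 1" by (simp add: k_def sqrt_one_minus_square[OF d(1)])
    finally have "norm (k * k) \<le> 1"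
      using norm_mult_ineq[of k k] by (simp add: power2_eq_square)
    then have "norm (1 - d) \<le> 1" by (simp add: k_def sqrt_one_minus_square[OF d(1)])
    moreover have "r *\<^sub>R 1 - a = r *\<^sub>R (1 - d)" using r0 by (simp add: d_def algebra_simps)
    ultimately show ?thesis using r0 by (simp add: mult_left_le)
  qed (use r in simp)
qed

lemma pos_cone_sqrt:
  fixes a :: "'a::unital_cstar_algebra"
  assumes "a \<in> pos_cone"
  obtains s where "s \<in> pos_cone" "s * s = a" "\<And>d. a * d = d * a \<Longrightarrow> s * d = d * s"
proof -
  have "norm (norm a *\<^sub>R 1 - a) \<le> norm a"
    using pos_cone_iff[OF pos_cone_sa[OF assms] order_refl] assms by simp
  then show thesis by (rule sa_sqrt_exists[OF pos_cone_sa[OF assms]]) (rule that)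
qed

lemma norm_minus_scaleR_1_imp_pos_cone:
  fixes a :: "'a::unital_cstar_algebra"
  assumes "adj a = a" "norm (r *\<^sub>R 1 - a) \<le> r"
  shows "a \<in> pos_cone"
proof -
  obtain s where "s \<in> pos_cone" "s * s = a" by (rule sa_sqrt_exists[OF assms])
  then show ?thesis using pos_coneI[OF pos_cone_sa[of s]] by simp
qed

lemma norm_scaleR_1_minus_pos_cone:
  fixes a :: "'a::unital_cstar_algebra"
  assumes "adj a = a" "norm a \<le> r"
  shows "r *\<^sub>R 1 - a \<in> pos_cone"
  using assms by (intro norm_minus_scaleR_1_imp_pos_cone[of _ r]) (simp_all add: adj_diff)

lemma pos_cone_add:
  fixes a b :: "'a::unital_cstar_algebra"
  assumes "a \<in> pos_cone" "b \<in> pos_cone"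
  shows "a + b \<in> pos_cone"
proof -
  have sa: "adj a = a" "adj b = b" using assms pos_cone_sa by blast+
  have "norm ((norm a *\<^sub>R 1 - a) + (norm b *\<^sub>R 1 - b)) \<le> norm a + norm b"
    using pos_cone_iff[OF sa(1) order_refl] pos_cone_iff[OF sa(2) order_refl] assms norm_triangle_mono
    by blast
  then show ?thesis
    by (intro norm_minus_scaleR_1_imp_pos_cone[of _ "norm a + norm b"])
      (simp_all add: adj_add sa algebra_simps)
qed

lemma pos_cone_mult_commuting:
  fixes a b :: "'a::unital_cstar_algebra"
  assumes "a \<in> pos_cone" "b \<in> pos_cone" "a * b = b * a"
  shows "a * b \<in> pos_cone"
proof -
  obtain s where s: "s \<in> pos_cone" "s * s = a" "\<And>d. a * d = d * a \<Longrightarrow> s * d = d * s"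
    using pos_cone_sqrt[OF assms(1)] by blast
  obtain t where t: "t \<in> pos_cone" "t * t = b" "\<And>d. b * d = d * b \<Longrightarrow> t * d = d * t"
    using pos_cone_sqrt[OF assms(2)] by blast
  have st: "s * t = t * s" using s(3)[of t] t(3)[of a] assms(3) by simp
  then have "(s * t) * (s * t) = a * b"
    unfolding s(2)[symmetric] t(2)[symmetric] by (metis mult.assoc)
  moreover have "adj (s * t) = s * t" using s(1) t(1) st by (simp add: adj_mult pos_cone_sa)
  ultimately show ?thesis using pos_coneI by metis
qed

lemma norm_le_commuting:
  fixes a b :: "'a::unital_cstar_algebra"
  assumes "a \<in> pos_cone" "b \<in> pos_cone" "a * b = b * a"
  shows "norm a \<le> norm (a + b)"
proof -
  obtain s where s: "s \<in> pos_cone" "s * s = a" "\<And>d. a * d = d * a \<Longrightarrow> s * d = d * s"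
    using pos_cone_sqrt[OF assms(1)] by blast
  obtain t where t: "t \<in> pos_cone" "t * t = b" "\<And>d. b * d = d * b \<Longrightarrow> t * d = d * t"
    using pos_cone_sqrt[OF assms(2)] by blast
  have st: "s * t = t * s" using s(3)[of t] t(3)[of a] assms(3) by simp
  have "norm a \<le> (norm s)\<^sup>2" using norm_mult_ineq[of s s] s(2) by (simp add: power2_eq_square)
  also have "\<dots> \<le> norm (a + b)"
    using norm_sa_square_le[OF _ _ st] s(1,2) t(1,2) by (simp add: pos_cone_sa)
  finally show ?thesis .
qed

lemma pos_cone_antisym:
  fixes a :: "'a::unital_cstar_algebra"
  assumes "a \<in> pos_cone" "- a \<in> pos_cone"
  shows "a = 0"
  using norm_le_commuting[OF assms] by simp

text \<open>
  With \<open>a \<le> b \<le> \<parallel>b\<parallel>\<close> the element \<open>\<parallel>b\<parallel> - a\<close> is positive, and it commutes with \<open>a\<close> even when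
  \<open>b\<close> does not; so the commuting case applies to \<open>a + (\<parallel>b\<parallel> - a)\<close>.
\<close>

lemma pos_cone_norm_mono:
  fixes a b :: "'a::unital_cstar_algebra"
  assumes a: "a \<in> pos_cone" and ab: "b - a \<in> pos_cone"
  shows "norm a \<le> norm b"
proof -
  have sa: "adj b = b" using pos_cone_sa[OF a] pos_cone_sa[OF ab] by (simp add: adj_diff)
  let ?c = "norm b *\<^sub>R 1 - a"
  have "(norm b *\<^sub>R 1 - b) + (b - a) \<in> pos_cone"
    by (intro pos_cone_add ab norm_scaleR_1_minus_pos_cone sa order_refl)
  then have "?c \<in> pos_cone" by simp
  from norm_le_commuting[OF a this] show ?thesis by (simp add: algebra_simps)
qed

lemma closed_pos_cone: "closed (pos_cone :: 'a::unital_cstar_algebra set)"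
  unfolding closed_sequential_limits
proof (intro allI impI, elim conjE)
  fix f :: "nat \<Rightarrow> 'a" and l
  assume f: "\<forall>n. f n \<in> pos_cone" and lim: "f \<longlonglongrightarrow> l"
  have "bounded (range f)" using lim by (rule convergent_imp_bounded)
  then obtain r where r: "\<And>n. norm (f n) \<le> r" by (auto simp: bounded_iff)
  have "norm (r *\<^sub>R 1 - f n) \<le> r" for n
    using pos_cone_iff[OF pos_cone_sa r] f by blast
  moreover have "(\<lambda>n. norm (r *\<^sub>R 1 - f n)) \<longlonglongrightarrow> norm (r *\<^sub>R 1 - l)"
    by (intro tendsto_intros lim)
  ultimately have "norm (r *\<^sub>R 1 - l) \<le> r" by (intro LIMSEQ_le_const2) auto
  moreover have "adj l = l"
  proof (rule LIMSEQ_unique)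
    show "f \<longlonglongrightarrow> adj l"
      using bounded_linear.tendsto[OF bounded_linear_adj lim] f by (simp add: pos_cone_sa)
  qed (rule lim)
  ultimately show "l \<in> pos_cone" by (intro norm_minus_scaleR_1_imp_pos_cone)
qed

section \<open>Positivity and invertibility\<close>

text \<open>
  For \<open>t = \<parallel>q\<parallel> + \<epsilon>\<close> write \<open>\<epsilon> + q = t - (\<parallel>q\<parallel> - q)\<close>. The subtracted element has norm at most
  \<open>\<parallel>q\<parallel> < t\<close>, so the geometric series applies.
\<close>

lemma has_inverse_pos_cone_plus:
  fixes q :: "'a::unital_cstar_algebra"
  assumes "q \<in> pos_cone" "\<epsilon> > 0"
  shows "has_inverse (\<epsilon> *\<^sub>R 1 + q)"
proof -
  define t where "t = norm q + \<epsilon>"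
  have t: "t > 0" using assms(2) by (simp add: t_def add_nonneg_pos)
  define c where "c = (1 / t) *\<^sub>R (norm q *\<^sub>R 1 - q)"
  have "norm c < 1"
    using pos_cone_iff[OF pos_cone_sa[OF assms(1)] order_refl] assms t by (simp add: c_def t_def)
  then have "has_inverse (t *\<^sub>R (1 - c))"
    using t by (intro has_inverse_scaleR has_inverse_one_minus) auto
  moreover have "t *\<^sub>R c = norm q *\<^sub>R 1 - q" using t by (simp add: c_def)
  then have "t *\<^sub>R (1 - c) = \<epsilon> *\<^sub>R 1 + q"
    unfolding scaleR_diff_right by (simp add: t_def scaleR_add_left)
  ultimately show ?thesis by simp
qed

text \<open>
  If \<open>g = b\<^sup>2\<close> is invertible then \<open>g - \<delta> = b (1 - \<delta> g\<inverse>) b\<close>. For small \<open>\<delta>\<close> the middle factor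
  is the square of an element commuting with \<open>b\<close>.
\<close>

lemma pos_cone_invertible_minus:
  fixes g :: "'a::unital_cstar_algebra"
  assumes "g \<in> pos_cone" "has_inverse g" "\<epsilon> > 0"
  obtains \<delta> where "0 < \<delta>" "\<delta> \<le> \<epsilon>" "g - \<delta> *\<^sub>R 1 \<in> pos_cone"
proof -
  obtain i where i: "g * i = 1" "i * g = 1" using assms(2) by (auto simp: has_inverse_def)
  obtain b where b: "adj b = b" "g = b * b" using assms(1) by (auto simp: pos_cone_def)
  \<comment> \<open>the summand \<open>1\<close> keeps the denominator positive; it gives \<open>\<parallel>\<delta> i\<parallel> \<le> 1\<close>\<close>
  define \<delta> where "\<delta> = min \<epsilon> (1 / (1 + norm i))"
  have \<delta>: "\<delta> > 0" using assms(3) by (simp add: \<delta>_def add_pos_nonneg)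
  have "norm i \<le> 1 + norm i" by simp
  then have "\<delta> * norm i \<le> 1 / (1 + norm i) * norm i"
    by (intro mult_right_mono) (auto simp: \<delta>_def)
  also have "\<dots> \<le> 1" by (simp add: divide_simps add_pos_nonneg)
  finally have n: "norm (\<delta> *\<^sub>R i) \<le> 1" using \<delta> by simp
  have sai: "adj i = i"
    by (metis adj_1 adj_mult i assms(1) mult.assoc mult_1_left mult_1_right pos_cone_sa)
  define k where "k = sqrt_one_minus (\<delta> *\<^sub>R i)"
  have kk: "k * k = 1 - \<delta> *\<^sub>R i" unfolding k_def by (rule sqrt_one_minus_square[OF n])
  have sak: "adj k = k" unfolding k_def using sai by (intro adj_sqrt_one_minus n) simp
  have "i * b = b * i" by (rule inverse_commutes[OF i]) (simp add: b mult.assoc)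
  then have kb: "k * b = b * k" unfolding k_def by (intro sqrt_one_minus_commutes n) simp
  have "(b * k) * (b * k) = b * b * (k * k)" by (metis kb mult.assoc)
  also have "\<dots> = g - \<delta> *\<^sub>R 1" unfolding kk b(2)[symmetric] using i by (simp add: algebra_simps)
  finally have "g - \<delta> *\<^sub>R 1 \<in> pos_cone"
    using pos_coneI[of "b * k"] b(1) sak kb by (simp add: adj_mult)
  then show thesis using that[of \<delta>] \<delta> by (simp add: \<delta>_def)
qed

text \<open>
  This stands in for the spectral radius formula. Let \<open>m\<close> be the least \<open>t \<ge> 0\<close> with \<open>t + h\<close>
  in the cone; it exists because the cone is closed. If \<open>m > 0\<close> then \<open>m + h\<close> is invertible,
  hence \<open>m - \<delta> + h\<close> is still in the cone for some \<open>\<delta> > 0\<close>, a contradiction.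
\<close>

lemma pos_coneI_invertible:
  fixes h :: "'a::unital_cstar_algebra"
  assumes sa: "adj h = h" and inv: "\<And>t. t > 0 \<Longrightarrow> has_inverse (t *\<^sub>R 1 + h)"
  shows "h \<in> pos_cone"
proof -
  define S where "S = {0..} \<inter> (\<lambda>t. t *\<^sub>R 1 + h) -` pos_cone"
  have S_iff: "t \<in> S \<longleftrightarrow> 0 \<le> t \<and> t *\<^sub>R 1 + h \<in> pos_cone" for t by (simp add: S_def)
  have "closed S" unfolding S_def
    by (intro closed_Int closed_atLeast closed_vimage closed_pos_cone continuous_intros)
  have "norm h \<in> S"
    using norm_scaleR_1_minus_pos_cone[of "- h" "norm h"] sa by (simp add: S_def)
  have bdd: "bdd_below S" by (auto simp: S_def bdd_below_def)
  have In: "Inf S \<in> S"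
    using closed_contains_Inf[OF _ bdd \<open>closed S\<close>] \<open>norm h \<in> S\<close> by blast
  have "Inf S = 0"
  proof (rule ccontr)
    assume "Inf S \<noteq> 0"
    then have pos: "Inf S > 0" using In S_iff by force
    obtain \<delta> where \<delta>: "0 < \<delta>" "\<delta> \<le> Inf S" "Inf S *\<^sub>R 1 + h - \<delta> *\<^sub>R 1 \<in> pos_cone"
      using pos_cone_invertible_minus[OF _ inv[OF pos] pos] In S_iff by metis
    have e: "(Inf S - \<delta>) *\<^sub>R 1 + h = Inf S *\<^sub>R 1 + h - \<delta> *\<^sub>R 1" by (simp add: algebra_simps)
    have "Inf S - \<delta> \<in> S" unfolding S_iff e using \<delta> by simp
    then have "Inf S \<le> Inf S - \<delta>" by (rule cInf_lower[OF _ bdd])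
    then show False using \<delta> by simp
  qed
  then show ?thesis using In S_iff[of 0] by simp
qed

text \<open>
  The product with \<open>h - i \<beta>\<close> is \<open>\<beta>\<^sup>2 + h\<^sup>2\<close>, which is invertible.
\<close>

lemma has_inverse_sa_nonreal:
  fixes h :: "'a::unital_cstar_algebra"
  assumes "adj h = h" "\<beta> \<noteq> 0"
  shows "has_inverse (h + \<beta> *\<^sub>R (\<i> *\<^sub>C 1))"
proof -
  let ?j = "\<beta> *\<^sub>R (\<i> *\<^sub>C 1) :: 'a"
  have jj: "?j * ?j = - (\<beta>\<^sup>2 *\<^sub>R 1)"
    by (simp add: scaleC_mult_left scaleC_scaleC scaleC_minus_left power2_eq_square)
  have hj: "h * ?j = ?j * h" by (simp add: scaleC_mult_left scaleC_mult_right)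
  have "(h + ?j) * (h - ?j) = h * h - ?j * ?j"
    using hj by (simp only: distrib_left distrib_right right_diff_distrib left_diff_distrib) simp
  also have "\<dots> = \<beta>\<^sup>2 *\<^sub>R 1 + h * h" unfolding jj by simp
  finally have e: "(h + ?j) * (h - ?j) = \<beta>\<^sup>2 *\<^sub>R 1 + h * h" .
  have "(h - ?j) * (h + ?j) = (h + ?j) * (h - ?j)"
    using hj by (simp only: distrib_left distrib_right right_diff_distrib left_diff_distrib) simp
  moreover have "has_inverse (\<beta>\<^sup>2 *\<^sub>R 1 + h * h)"
    using assms by (intro has_inverse_pos_cone_plus pos_coneI) auto
  ultimately show ?thesis using has_inverse_left_factor[of "h + ?j" "h - ?j"] e by simp
qed

text \<open>
  With \<open>h = b\<^sup>2\<close> and \<open>b\<close> invertible, \<open>h + i k = b (1 + i b\<inverse> k b\<inverse>) b\<close>, and the middle factor is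
  invertible because \<open>b\<inverse> k b\<inverse>\<close> is self-adjoint.
\<close>

lemma has_inverse_accretive:
  fixes h k :: "'a::unital_cstar_algebra"
  assumes h: "h - \<epsilon> *\<^sub>R 1 \<in> pos_cone" and \<epsilon>: "\<epsilon> > 0" and k: "adj k = k"
  shows "has_inverse (h + \<i> *\<^sub>C k)"
proof -
  have "h \<in> pos_cone"
    using pos_cone_add[OF h pos_cone_scaleR_1[of \<epsilon>]] \<epsilon> by simp
  then obtain b where b: "adj b = b" "b * b = h" by (auto simp: pos_cone_def)
  have "has_inverse (b * b)" using has_inverse_pos_cone_plus[OF h \<epsilon>] b(2) by simp
  then have bi: "has_inverse b" by (rule has_inverse_left_factor) simp
  then obtain c where c: "b * c = 1" "c * b = 1" by (auto simp: has_inverse_def)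
  have sac: "adj c = c"
    by (metis adj_1 adj_mult b(1) c mult.assoc mult_1_left mult_1_right)
  have "h + \<i> *\<^sub>C k = b * (1 + \<i> *\<^sub>C (c * k * c)) * b"
  proof -
    have "b * (c * k * c) * b = (b * c) * k * (c * b)" by (simp only: mult.assoc)
    then have "b * (c * k * c) * b = k" using c by simp
    then show ?thesis
      using b(2) by (simp add: distrib_left distrib_right scaleC_mult_left scaleC_mult_right)
  qed
  moreover have "has_inverse (1 + \<i> *\<^sub>C (c * k * c))"
  proof -
    let ?l = "c * k * c"
    have "adj (- ?l) = - ?l" using sac k by (simp add: adj_mult mult.assoc)
    from has_inverse_sa_nonreal[OF this, of 1] obtain m where
      m: "(- ?l + \<i> *\<^sub>C 1) * m = 1" "m * (- ?l + \<i> *\<^sub>C 1) = 1" by (auto simp: has_inverse_def)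
    have "\<i> *\<^sub>C (- ?l + \<i> *\<^sub>C 1) = - (1 + \<i> *\<^sub>C ?l)"
      by (simp add: scaleC_diff_right scaleC_add_right scaleC_minus_right scaleC_scaleC scaleC_minus_left)
    then have e: "1 + \<i> *\<^sub>C ?l = (- \<i>) *\<^sub>C (- ?l + \<i> *\<^sub>C 1)"
      by (simp add: scaleC_minus_left)
    show ?thesis unfolding e has_inverse_def using m
      by (intro exI[of _ "\<i> *\<^sub>C m"]) (simp add: scaleC_mult_left scaleC_mult_right scaleC_scaleC)
  qed
  ultimately show ?thesis using bi by (auto intro: has_inverse_mult)
qed

section \<open>Operator monotonicity of the square root\<close>

text \<open>
  It suffices that \<open>t + q - p\<close> is invertible for every \<open>t > 0\<close>. Multiplied from the left by
  the invertible element \<open>t + q + p\<close> it becomes \<open>(t + q)\<^sup>2 - p\<^sup>2 + [p,q]\<close>. The first two terms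
  have a sum of at least \<open>t\<^sup>2\<close>, and the commutator is \<open>i\<close> times a self-adjoint element.
\<close>

lemma pos_cone_sqrt_mono:
  fixes p q :: "'a::unital_cstar_algebra"
  assumes p: "p \<in> pos_cone" and q: "q \<in> pos_cone" and le: "q * q - p * p \<in> pos_cone"
  shows "q - p \<in> pos_cone"
proof (rule pos_coneI_invertible)
  have sa: "adj p = p" "adj q = q" using p q pos_cone_sa by blast+
  then show "adj (q - p) = q - p" by (simp add: adj_diff)
  fix t :: real assume t: "t > 0"
  define h where "h = t\<^sup>2 *\<^sub>R 1 + (q * q - p * p) + (2 * t) *\<^sub>R q"
  define k where "k = (- \<i>) *\<^sub>C (p * q - q * p)"
  have "h - t\<^sup>2 *\<^sub>R 1 \<in> pos_cone"
    using pos_cone_add[OF le pos_cone_scaleR[OF q, of "2 * t"]] t by (simp add: h_def)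
  moreover have "adj k = k"
    by (simp add: k_def adj_scaleC adj_diff adj_mult sa scaleC_minus_left flip: scaleC_minus_right)
  ultimately have "has_inverse (h + \<i> *\<^sub>C k)" using t has_inverse_accretive[of h "t\<^sup>2" k] by simp
  also have "h + \<i> *\<^sub>C k = (t *\<^sub>R 1 + q + p) * (t *\<^sub>R 1 + (q - p))"
    by (simp add: h_def k_def scaleC_scaleC scaleC_diff_right algebra_simps power2_eq_square scaleR_2 scaleR_add_left
        flip: scaleR_scaleR)
  finally have "has_inverse ((t *\<^sub>R 1 + q + p) * (t *\<^sub>R 1 + (q - p)))" .
  moreover have "has_inverse (t *\<^sub>R 1 + q + p)"
    using has_inverse_pos_cone_plus[OF pos_cone_add[OF q p] t] by (simp add: add.assoc)
  ultimately show "has_inverse (t *\<^sub>R 1 + (q - p))" by (rule has_inverse_cancel_left)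
qed

section \<open>Positivity of a*a\<close>

text \<open>
  Here \<open>s\<close> plays the role of \<open>\<bar>h\<bar>\<close>, so that \<open>s - h\<close> is twice the negative part of \<open>h\<close>. Its
  positivity follows because \<open>(t + s - h) (t + s + h) = t\<^sup>2 + 2 t s\<close> is invertible.
\<close>

lemma abs_minus_in_pos_cone:
  fixes h s :: "'a::unital_cstar_algebra"
  assumes sa: "adj h = h" and s: "s \<in> pos_cone" "s * s = h * h" and comm: "s * h = h * s"
  shows "s - h \<in> pos_cone"
proof (rule pos_coneI_invertible)
  show "adj (s - h) = s - h" using sa s(1) by (simp add: adj_diff pos_cone_sa)
  fix t :: real assume t: "t > 0"
  let ?u = "t *\<^sub>R 1 + (s - h)" and ?v = "t *\<^sub>R 1 + (s + h)"
  have "?u * ?v = t\<^sup>2 *\<^sub>R 1 + (2 * t) *\<^sub>R s"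
    using s(2) comm by (simp add: algebra_simps power2_eq_square scaleR_2 scaleR_add_left)
      (simp add: mult.commute[of t] flip: scaleR_2)
  moreover have "?u * ?v = ?v * ?u" using comm by (simp add: algebra_simps)
  moreover have "has_inverse (t\<^sup>2 *\<^sub>R 1 + (2 * t) *\<^sub>R s)"
    using t by (intro has_inverse_pos_cone_plus pos_cone_scaleR s) auto
  ultimately show "has_inverse ?u" using has_inverse_left_factor by metis
qed

text \<open>
  Apart from \<open>0\<close>, the products \<open>a b\<close> and \<open>b a\<close> have the same spectrum: if \<open>m\<close> inverts
  \<open>t + a b\<close> then \<open>(1 - b m a) / t\<close> inverts \<open>t + b a\<close>.
\<close>

lemma has_inverse_plus_mult_swap:
  fixes a b :: "'a::unital_cstar_algebra"
  assumes "t > 0" "has_inverse (t *\<^sub>R 1 + a * b)"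
  shows "has_inverse (t *\<^sub>R 1 + b * a)"
proof -
  obtain m where m: "(t *\<^sub>R 1 + a * b) * m = 1" "m * (t *\<^sub>R 1 + a * b) = 1"
    using assms(2) by (auto simp: has_inverse_def)
  have e: "a * b * m = 1 - t *\<^sub>R m" "m * a * b = 1 - t *\<^sub>R m"
    using m by (simp_all add: algebra_simps)
  define w z where "w = b * a" and "z = b * m * a"
  have "w * z = b * (a * b * m) * a" unfolding w_def z_def by (simp only: mult.assoc)
  also have "\<dots> = w - t *\<^sub>R z" unfolding e(1) w_def z_def by (simp add: algebra_simps)
  finally have wz: "w * z = w - t *\<^sub>R z" .
  have "z * w = b * (m * a * b) * a" unfolding w_def z_def by (simp only: mult.assoc)
  also have "\<dots> = w - t *\<^sub>R z" unfolding e(2) w_def z_def by (simp add: algebra_simps)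
  finally have zw: "z * w = w - t *\<^sub>R z" .
  have "(t *\<^sub>R 1 + w) * ((1 / t) *\<^sub>R (1 - z)) = 1" "((1 / t) *\<^sub>R (1 - z)) * (t *\<^sub>R 1 + w) = 1"
    using assms(1) by (simp_all add: algebra_simps wz zw)
  then show ?thesis unfolding has_inverse_def w_def by blast
qed

text \<open>
  With \<open>u\<close> and \<open>v\<close> twice the real and, up to sign, the imaginary part of \<open>c\<close>, one has
  \<open>c c\<^sup>* + c\<^sup>* c = (u\<^sup>2 + v\<^sup>2) / 2\<close>. If \<open>- c\<^sup>* c\<close> is positive then so is \<open>c c\<^sup>*\<close>, hence also
  \<open>c\<^sup>* c\<close>, which therefore vanishes.
\<close>

lemma adj_mult_self_neg_imp_0:
  fixes c :: "'a::unital_cstar_algebra"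
  assumes neg: "- (adj c * c) \<in> pos_cone"
  shows "c = 0"
proof -
  define u where "u = c + adj c"
  define v where "v = \<i> *\<^sub>C (c - adj c)"
  have u: "adj u = u" by (simp add: u_def adj_add adj_adj add.commute)
  have v: "adj v = v"
    by (simp add: v_def adj_scaleC adj_diff adj_adj scaleC_minus_left flip: scaleC_minus_right)
  have "u * u + v * v = 2 *\<^sub>R (c * adj c + adj c * c)"
    by (simp add: u_def v_def scaleC_mult_left scaleC_mult_right scaleC_scaleC scaleC_minus_left
        scaleC_diff_right algebra_simps scaleR_2)
  then have "c * adj c = (1/2) *\<^sub>R (u * u + v * v) + - (adj c * c)" by simp
  moreover have "\<dots> \<in> pos_cone"
    by (intro pos_cone_add pos_cone_scaleR pos_coneI u v neg) simp
  ultimately have "c * adj c \<in> pos_cone" by simp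
  then have "has_inverse (t *\<^sub>R 1 + adj c * c)" if "t > 0" for t
    using that by (intro has_inverse_plus_mult_swap[of t c "adj c"] has_inverse_pos_cone_plus)
  then have "adj c * c \<in> pos_cone"
    by (intro pos_coneI_invertible) (simp_all add: adj_mult adj_adj)
  then show ?thesis using pos_cone_antisym[OF _ neg] adj_mult_self_eq_0 by blast
qed

text \<open>
  Let \<open>h = a\<^sup>* a\<close>, \<open>s = \<bar>h\<bar>\<close> and \<open>g\<^sup>2 = s - h\<close>. Then \<open>c = a g\<close> satisfies
  \<open>- c\<^sup>* c = - g h g = s (s - h)\<close>, a product of commuting positive elements, so \<open>c = 0\<close>. From
  \<open>s (s - h) = 0\<close> and \<open>s\<^sup>2 = h\<^sup>2\<close> follows \<open>(s - h)\<^sup>2 = 0\<close>, that is \<open>h = s\<close>.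
\<close>

lemma adj_mult_self_in_pos_cone:
  fixes a :: "'a::unital_cstar_algebra"
  shows "adj a * a \<in> pos_cone"
proof -
  define h where "h = adj a * a"
  have sah: "adj h = h" by (simp add: h_def adj_mult adj_adj)
  obtain s where s: "s \<in> pos_cone" "s * s = h * h" "\<And>d. h * h * d = d * (h * h) \<Longrightarrow> s * d = d * s"
    using pos_cone_sqrt[OF pos_coneI[OF sah]] by blast
  have sh: "s * h = h * s" by (rule s(3)) (simp add: mult.assoc)
  have d: "s - h \<in> pos_cone" by (rule abs_minus_in_pos_cone[OF sah s(1,2) sh])
  obtain g where g: "g \<in> pos_cone" "g * g = s - h" "\<And>d. (s - h) * d = d * (s - h) \<Longrightarrow> g * d = d * g"
    using pos_cone_sqrt[OF d] by blast
  have gh: "g * h = h * g" by (rule g(3)) (simp add: algebra_simps sh)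
  have "- (adj (a * g) * (a * g)) = - (g * h * g)"
    using g(1) by (simp add: adj_mult pos_cone_sa h_def mult.assoc)
  also have "g * h * g = h * (s - h)" using gh g(2) by (simp add: mult.assoc)
  also have "- (h * (s - h)) = s * (s - h)" using s(2) sh by (simp add: algebra_simps)
  finally have e: "- (adj (a * g) * (a * g)) = s * (s - h)" .
  have sp: "s * (s - h) \<in> pos_cone"
    by (rule pos_cone_mult_commuting[OF s(1) d]) (simp add: algebra_simps sh)
  then have "a * g = 0" using e adj_mult_self_neg_imp_0[of "a * g"] by simp
  then have z: "s * (s - h) = 0" using e by simp
  then have "(s - h) * (s - h) = 0" using s(2) sh by (simp add: algebra_simps)
  then have "s - h = 0" using pos_cone_sa[OF d] sa_square_eq_0 by blast
  then show ?thesis using s(1) h_def by simp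
qed

lemma pos_cone_conj:
  fixes a c :: "'a::unital_cstar_algebra"
  assumes "a \<in> pos_cone"
  shows "adj c * a * c \<in> pos_cone"
proof -
  obtain b where "adj b = b" "a = b * b" using assms by (auto simp: pos_cone_def)
  then show ?thesis
    using adj_mult_self_in_pos_cone[of "b * c"] by (simp add: adj_mult mult.assoc)
qed

section \<open>The unitization\<close>

text \<open>
  An element \<open>Unitization a s\<close> stands for \<open>a + s 1\<close>. Its norm is the larger of \<open>\<bar>s\<bar>\<close> and the
  norm of the left multiplication it induces on the algebra. The second quantity alone is
  only a seminorm if the algebra already has a unit; the maximum of the two is a C*-norm in
  every case.
\<close>

datatype 'a unitization = Unitization (alg_part: 'a) (scalar_part: complex)

lemma unitization_eq_iff: "u = v \<longleftrightarrow> alg_part u = alg_part v \<and> scalar_part u = scalar_part v"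
  by (cases u; cases v) simp

instantiation unitization :: (cstar_algebra) real_algebra_1
begin

definition "0 = Unitization 0 0"
definition "1 = Unitization 0 1"
definition "u + v = Unitization (alg_part u + alg_part v) (scalar_part u + scalar_part v)"
definition "- u = Unitization (- alg_part u) (- scalar_part u)"
definition "u - v = Unitization (alg_part u - alg_part v) (scalar_part u - scalar_part v)"
definition "r *\<^sub>R u = Unitization (r *\<^sub>R alg_part u) (r *\<^sub>R scalar_part u)"
definition "u * v = Unitization
  (alg_part u * alg_part v + scalar_part u *\<^sub>C alg_part v + scalar_part v *\<^sub>C alg_part u)
  (scalar_part u * scalar_part v)"

lemma unitization_parts [simp]:
  "alg_part 0 = 0" "scalar_part 0 = 0"
  "alg_part 1 = 0" "scalar_part 1 = 1"
  "alg_part (u + v) = alg_part u + alg_part v"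
  "scalar_part (u + v) = scalar_part u + scalar_part v"
  "alg_part (- u) = - alg_part u" "scalar_part (- u) = - scalar_part u"
  "alg_part (u - v) = alg_part u - alg_part v"
  "scalar_part (u - v) = scalar_part u - scalar_part v"
  "alg_part (r *\<^sub>R u) = r *\<^sub>R alg_part u" "scalar_part (r *\<^sub>R u) = r *\<^sub>R scalar_part u"
  "alg_part (u * v) =
    alg_part u * alg_part v + scalar_part u *\<^sub>C alg_part v + scalar_part v *\<^sub>C alg_part u"
  "scalar_part (u * v) = scalar_part u * scalar_part v"
  by (simp_all add: zero_unitization_def one_unitization_def plus_unitization_def
      uminus_unitization_def minus_unitization_def scaleR_unitization_def times_unitization_def)

instance
  by standard
    (simp_all add: unitization_eq_iff algebra_simps scaleC_mult_left scaleC_mult_right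
      scaleC_add_right scaleC_add_left scaleC_scaleC scaleR_conv_of_real[where 'a = complex]
      flip: scaleC_of_real)

end

definition left_mult :: "'a::cstar_algebra unitization \<Rightarrow> 'a \<Rightarrow> 'a" where
  "left_mult u b = alg_part u * b + scalar_part u *\<^sub>C b"

lemma bounded_linear_left_mult: "bounded_linear (left_mult u)"
proof (rule bounded_linear_intro)
  fix b
  show "norm (left_mult u b) \<le> norm b * (norm (alg_part u) + cmod (scalar_part u))"
    unfolding left_mult_def
    using norm_triangle_ineq[of "alg_part u * b" "scalar_part u *\<^sub>C b"]
      norm_mult_ineq[of "alg_part u" b] by (simp add: norm_scaleC algebra_simps)
qed (simp_all add: left_mult_def algebra_simps scaleC_add_right scaleR_scaleC)

lemma left_mult_mult: "left_mult (u * v) = left_mult u \<circ> left_mult v"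
  by (rule ext) (simp add: left_mult_def algebra_simps scaleC_mult_left scaleC_mult_right
      scaleC_add_right scaleC_scaleC)

lemma left_mult_add: "left_mult (u + v) = (\<lambda>b. left_mult u b + left_mult v b)"
  by (rule ext) (simp add: left_mult_def algebra_simps scaleC_add_left)

lemma left_mult_scaleR: "left_mult (r *\<^sub>R u) = (\<lambda>b. r *\<^sub>R left_mult u b)"
  by (rule ext) (simp add: left_mult_def algebra_simps scaleC_add_right scaleC_scaleC
      scaleC_mult_left scaleR_conv_of_real[where 'a = complex] flip: scaleC_of_real)

lemma left_mult_0: "left_mult 0 = (\<lambda>b. 0)"
  by (rule ext) (simp add: left_mult_def)

instantiation unitization :: (cstar_algebra) real_normed_algebra_1
begin

definition "norm u = max (onorm (left_mult u)) (cmod (scalar_part u))"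
definition "sgn u = inverse (norm u) *\<^sub>R u" for u :: "'a unitization"
definition "dist u v = norm (u - v)" for u v :: "'a unitization"
definition [code del]: "(uniformity :: ('a unitization \<times> 'a unitization) filter) =
  (INF e\<in>{0<..}. principal {(u, v). dist u v < e})"
definition [code del]: "open U \<longleftrightarrow> (\<forall>u\<in>U. \<forall>\<^sub>F (u', v) in uniformity. u' = u \<longrightarrow> v \<in> U)"
  for U :: "'a unitization set"

lemma norm_left_mult_le: "norm (left_mult u b) \<le> norm u * norm b"
proof -
  have "norm (left_mult u b) \<le> onorm (left_mult u) * norm b"
    by (rule onorm[OF bounded_linear_left_mult])
  also have "\<dots> \<le> norm u * norm b"
    by (rule mult_right_mono) (simp_all add: norm_unitization_def)
  finally show ?thesis .
qed

lemma norm_scalar_part_le: "cmod (scalar_part u) \<le> norm u"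
  by (simp add: norm_unitization_def)

lemma norm_unitization_le:
  assumes "\<And>b. norm (left_mult u b) \<le> r * norm b" "cmod (scalar_part u) \<le> r"
  shows "norm u \<le> r"
  unfolding norm_unitization_def
  using assms order_trans[OF norm_ge_zero assms(2)] by (simp add: onorm_bound)

text \<open>
  The algebra part is recovered from the left multiplication by applying it to \<open>a\<^sup>*\<close>. Together
  with \<open>norm_scalar_part_le\<close> this makes the norm definite and equivalent to a product norm,
  which gives completeness.
\<close>

lemma norm_alg_part_le: "norm (alg_part u) \<le> 2 * norm u"
proof (cases "alg_part u = 0")
  case False
  let ?a = "alg_part u"
  have "norm ?a * norm ?a = norm (?a * adj ?a)"
    using cstar_identity[of "adj ?a"] by (simp add: adj_adj power2_eq_square)
  also have "?a * adj ?a = left_mult u (adj ?a) - scalar_part u *\<^sub>C adj ?a"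
    by (simp add: left_mult_def)
  also have "norm \<dots> \<le> norm (left_mult u (adj ?a)) + cmod (scalar_part u) * norm ?a"
    using norm_triangle_ineq4[of "left_mult u (adj ?a)" "scalar_part u *\<^sub>C adj ?a"]
    by (simp add: norm_scaleC)
  also have "\<dots> \<le> norm u * norm ?a + norm u * norm ?a"
    using norm_left_mult_le[of u "adj ?a"] norm_scalar_part_le[of u]
    by (intro add_mono mult_right_mono) auto
  finally show ?thesis using False by simp
qed (simp add: norm_unitization_def le_max_iff_disj)

instance
proof
  fix u v :: "'a unitization" and r :: real
  show "norm u = 0 \<longleftrightarrow> u = 0"
  proof
    assume "norm u = 0"
    then show "u = 0"
      using norm_alg_part_le[of u] norm_scalar_part_le[of u] by (simp add: unitization_eq_iff)
  qed (simp add: norm_unitization_def left_mult_0 onorm_zero)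
  show "norm (u + v) \<le> norm u + norm v"
    unfolding norm_unitization_def left_mult_add
    using onorm_triangle[OF bounded_linear_left_mult[of u] bounded_linear_left_mult[of v]]
      norm_triangle_ineq[of "scalar_part u" "scalar_part v"] by (auto simp: max_def)
  show "norm (r *\<^sub>R u) = \<bar>r\<bar> * norm u"
    unfolding norm_unitization_def left_mult_scaleR
    using onorm_scaleR[OF bounded_linear_left_mult[of u]] by (simp add: max_mult_distrib_left)
  show "norm (u * v) \<le> norm u * norm v"
  proof (rule norm_unitization_le)
    fix b
    have "norm (left_mult (u * v) b) \<le> norm u * norm (left_mult v b)"
      unfolding left_mult_mult comp_def by (rule norm_left_mult_le)
    also have "\<dots> \<le> norm u * (norm v * norm b)"
      using norm_scalar_part_le[of u] norm_ge_zero[of "scalar_part u"]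
      by (intro mult_left_mono norm_left_mult_le) linarith
    finally show "norm (left_mult (u * v) b) \<le> norm u * norm v * norm b" by simp
    show "cmod (scalar_part (u * v)) \<le> norm u * norm v"
      using norm_scalar_part_le[of u] norm_scalar_part_le[of v] norm_ge_zero[of "scalar_part u"]
      by (simp add: norm_mult mult_mono')
  qed
  show "norm (1::'a unitization) = 1"
  proof (rule antisym)
    show "norm (1::'a unitization) \<le> 1"
      by (rule norm_unitization_le) (simp_all add: left_mult_def)
    show "1 \<le> norm (1::'a unitization)"
      using norm_scalar_part_le[of "1::'a unitization"] by simp
  qed
qed (simp_all add: dist_unitization_def sgn_unitization_def uniformity_unitization_def
    open_unitization_def)

end

instance unitization :: (cstar_algebra) banach
proof
  fix X :: "nat \<Rightarrow> 'a unitization"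
  assume X: "Cauchy X"
  have cauchy: "Cauchy (\<lambda>n. f (X n))"
    if diff: "\<And>u v. f (u - v) = f u - f v" and bound: "\<And>u. norm (f u) \<le> 2 * norm u"
    for f :: "'a unitization \<Rightarrow> 'b::real_normed_vector"
  proof (rule CauchyI)
    fix e :: real assume "e > 0"
    then obtain M where M: "\<And>m n. m \<ge> M \<Longrightarrow> n \<ge> M \<Longrightarrow> norm (X m - X n) < e / 2"
      using CauchyD[OF X, of "e / 2"] by auto
    have "norm (f (X m) - f (X n)) < e" if "m \<ge> M" "n \<ge> M" for m n
      using M[OF that] bound[of "X m - X n"] by (simp add: diff)
    then show "\<exists>M. \<forall>m\<ge>M. \<forall>n\<ge>M. norm (f (X m) - f (X n)) < e" by blast
  qed
  have "Cauchy (\<lambda>n. alg_part (X n))" "Cauchy (\<lambda>n. scalar_part (X n))"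
    by (rule cauchy; simp add: norm_alg_part_le order_trans[OF norm_scalar_part_le])+
  then obtain a s where lim: "(\<lambda>n. alg_part (X n)) \<longlonglongrightarrow> a" "(\<lambda>n. scalar_part (X n)) \<longlonglongrightarrow> s"
    using Cauchy_convergent convergent_def by metis
  have "(\<lambda>n. X n - Unitization a s) \<longlonglongrightarrow> 0"
  proof (rule Lim_null_comparison)
    show "(\<lambda>n. norm (alg_part (X n) - a) + cmod (scalar_part (X n) - s)) \<longlonglongrightarrow> 0"
      using lim[THEN LIM_zero, THEN tendsto_norm_zero] by (rule tendsto_add_zero)
    have "norm (X n - Unitization a s) \<le> norm (alg_part (X n) - a) + cmod (scalar_part (X n) - s)" for n
    proof (rule norm_unitization_le)
      fix b
      show "norm (left_mult (X n - Unitization a s) b) \<le>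
          (norm (alg_part (X n) - a) + cmod (scalar_part (X n) - s)) * norm b"
        unfolding left_mult_def distrib_right
        by (rule norm_triangle_mono) (simp_all add: norm_mult_ineq norm_scaleC)
    qed simp
    then show "\<forall>\<^sub>F n in sequentially. norm (X n - Unitization a s) \<le>
        norm (alg_part (X n) - a) + cmod (scalar_part (X n) - s)" by simp
  qed
  then show "convergent X" unfolding convergent_def using LIM_zero_cancel by blast
qed

instantiation unitization :: (cstar_algebra) unital_cstar_algebra
begin

definition "s *\<^sub>C u = Unitization (s *\<^sub>C alg_part u) (s * scalar_part u)"
definition "adj u = Unitization (adj (alg_part u)) (cnj (scalar_part u))"

lemma unitization_star_parts [simp]:
  "alg_part (s *\<^sub>C u) = s *\<^sub>C alg_part u" "scalar_part (s *\<^sub>C u) = s * scalar_part u"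
  "alg_part (adj u) = adj (alg_part u)" "scalar_part (adj u) = cnj (scalar_part u)"
  by (simp_all add: scaleC_unitization_def adj_unitization_def)

lemma left_mult_scaleC: "left_mult (s *\<^sub>C u) b = s *\<^sub>C left_mult u b"
  by (simp add: left_mult_def scaleC_mult_left scaleC_add_right scaleC_scaleC)

lemma unitization_adj_mult: "adj (u * v) = adj v * adj (u :: 'a unitization)"
  by (simp add: unitization_eq_iff adj_mult adj_add adj_scaleC algebra_simps)

text \<open>
  The substantial half of the C*-identity. Both components of the norm are compared with
  \<open>sqrt \<parallel>u\<^sup>* u\<parallel>\<close>; for the left multiplication this uses
  \<open>(u b)\<^sup>* (u b) = b\<^sup>* ((u\<^sup>* u) b)\<close> and the C*-identity in the algebra.
\<close>

lemma unitization_norm_square_le: "(norm u)\<^sup>2 \<le> norm (adj u * u)" for u :: "'a unitization"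
proof -
  let ?r = "sqrt (norm (adj u * u))"
  have adj_left_mult: "adj (left_mult u b) * left_mult u b = adj b * left_mult (adj u * u) b" for b
    unfolding left_mult_mult
    by (simp add: left_mult_def adj_add adj_mult adj_scaleC algebra_simps scaleC_mult_left
        scaleC_mult_right scaleC_add_right scaleC_scaleC)
  have "norm u \<le> ?r"
  proof (rule norm_unitization_le)
    fix b
    have "(norm (left_mult u b))\<^sup>2 = norm (adj b * left_mult (adj u * u) b)"
      by (simp only: cstar_identity[symmetric] adj_left_mult)
    also have "\<dots> \<le> norm b * norm (left_mult (adj u * u) b)"
      using norm_mult_ineq[of "adj b"] by simp
    also have "\<dots> \<le> norm b * (norm (adj u * u) * norm b)"
      by (intro mult_left_mono norm_left_mult_le) simp
    also have "\<dots> = (?r * norm b)\<^sup>2" by (simp add: power2_eq_square algebra_simps)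
    finally show "norm (left_mult u b) \<le> ?r * norm b" by (rule power2_le_imp_le) simp
  next
    have "(cmod (scalar_part u))\<^sup>2 \<le> norm (adj u * u)"
      using norm_scalar_part_le[of "adj u * u"] by (simp add: norm_mult power2_eq_square)
    then show "cmod (scalar_part u) \<le> ?r" by (rule real_le_rsqrt)
  qed
  then have "(norm u)\<^sup>2 \<le> ?r\<^sup>2" by (rule power_mono) simp
  then show ?thesis by simp
qed

instance
proof
  fix u v :: "'a unitization" and s t :: complex and r :: real
  show "s *\<^sub>C (u + v) = s *\<^sub>C u + s *\<^sub>C v"
    by (simp add: unitization_eq_iff scaleC_add_right algebra_simps)
  show "(s + t) *\<^sub>C u = s *\<^sub>C u + t *\<^sub>C u"
    by (simp add: unitization_eq_iff scaleC_add_left algebra_simps)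
  show "s *\<^sub>C t *\<^sub>C u = (s * t) *\<^sub>C u"
    by (simp add: unitization_eq_iff scaleC_scaleC)
  show "complex_of_real r *\<^sub>C u = r *\<^sub>R u"
    by (simp add: unitization_eq_iff scaleC_of_real scaleR_conv_of_real[where 'a = complex])
  show "(s *\<^sub>C u) * v = s *\<^sub>C (u * v)" "u * (s *\<^sub>C v) = s *\<^sub>C (u * v)"
    by (simp_all add: unitization_eq_iff scaleC_mult_left scaleC_mult_right scaleC_add_right
        scaleC_scaleC mult.commute mult.left_commute)
  show "adj (u + v) = adj u + adj v" by (simp add: unitization_eq_iff adj_add)
  show "adj (s *\<^sub>C u) = cnj s *\<^sub>C adj u" by (simp add: unitization_eq_iff adj_scaleC)
  show "adj (u * v) = adj v * adj u" by (rule unitization_adj_mult)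
  show adj_adj: "adj (adj u) = u" for u :: "'a unitization"
    by (simp add: unitization_eq_iff adj_adj)
  have le: "norm w \<le> norm (adj w)" for w :: "'a unitization"
  proof (cases "w = 0")
    case False
    have "norm w * norm w \<le> norm (adj w) * norm w"
      using unitization_norm_square_le[of w] norm_mult_ineq[of "adj w" w] by (simp add: power2_eq_square)
    with False show ?thesis by simp
  qed simp
  have na: "norm (adj u) = norm u" using le[of u] le[of "adj u"] by (simp add: adj_adj)
  show "norm (adj u * u) = (norm u)\<^sup>2"
    using unitization_norm_square_le[of u] norm_mult_ineq[of "adj u" u] na by (simp add: power2_eq_square)
  show "norm (s *\<^sub>C u) = cmod s * norm u"
  proof (rule antisym)
    have le: "norm (s *\<^sub>C u) \<le> cmod s * norm u" for s and u :: "'a unitization"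
    proof (rule norm_unitization_le)
      fix b
      show "norm (left_mult (s *\<^sub>C u) b) \<le> cmod s * norm u * norm b"
        using norm_left_mult_le[of u b]
        by (simp add: left_mult_scaleC norm_scaleC mult_left_mono mult.assoc)
      show "cmod (scalar_part (s *\<^sub>C u)) \<le> cmod s * norm u"
        by (simp add: norm_mult mult_left_mono norm_scalar_part_le)
    qed
    then show "norm (s *\<^sub>C u) \<le> cmod s * norm u" .
    show "cmod s * norm u \<le> norm (s *\<^sub>C u)"
    proof (cases "s = 0")
      case False
      have "u = inverse s *\<^sub>C s *\<^sub>C u"
        using False by (simp add: unitization_eq_iff scaleC_scaleC)
      then have "norm u \<le> cmod (inverse s) * norm (s *\<^sub>C u)" using le by metis
      then show ?thesis using False by (simp add: norm_inverse norm_divide field_simps)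
    qed simp
  qed
qed

end

section \<open>Positive elements and their square roots\<close>

definition embed :: "'a::cstar_algebra \<Rightarrow> 'a unitization" where
  "embed a = Unitization a 0"

lemma embed_simps [simp]:
  "embed (a + b) = embed a + embed b" "embed (a - b) = embed a - embed b"
  "embed (- a) = - embed a" "embed 0 = 0"
  "embed (a * b) = embed a * embed b" "embed (r *\<^sub>R a) = r *\<^sub>R embed a"
  "embed (adj a) = adj (embed a)"
  "alg_part (embed a) = a" "scalar_part (embed a) = 0"
  by (simp_all add: embed_def unitization_eq_iff)

lemma embed_inject [simp]: "embed a = embed b \<longleftrightarrow> a = b"
  by (simp add: embed_def)

lemma norm_embed [simp]: "norm (embed a) = norm a"
proof (rule antisym)
  show "norm (embed a) \<le> norm a"
    by (rule norm_unitization_le) (simp_all add: left_mult_def norm_mult_ineq)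
  have "norm a * norm a = norm (left_mult (embed a) (adj a))"
    using cstar_identity[of "adj a"] by (simp add: left_mult_def adj_adj power2_eq_square)
  also have "\<dots> \<le> norm (embed a) * norm a"
    using norm_left_mult_le[of "embed a" "adj a"] by simp
  finally show "norm a \<le> norm (embed a)" by (cases "a = 0") simp_all
qed

lemma in_spectrum_iff: "s \<in> spectrum a \<longleftrightarrow> \<not> has_inverse (Unitization (- a) s)"
proof -
  have mult: "Unitization (fst u) (snd u) * Unitization (fst v) (snd v) = 1 \<longleftrightarrow>
      unitization_mult u v = (0, 1)" for u v :: "'a \<times> complex"
    by (simp add: unitization_eq_iff unitization_mult_def)
  have "unitization_invertible u \<longleftrightarrow> has_inverse (Unitization (fst u) (snd u))" for u :: "'a \<times> complex"
  proof
    assume "unitization_invertible u"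
    then show "has_inverse (Unitization (fst u) (snd u))"
      unfolding unitization_invertible_def has_inverse_def mult[symmetric] by blast
  next
    assume "has_inverse (Unitization (fst u) (snd u))"
    then obtain w where "Unitization (fst u) (snd u) * w = 1" "w * Unitization (fst u) (snd u) = 1"
      by (auto simp: has_inverse_def)
    then show "unitization_invertible u"
      unfolding unitization_invertible_def mult[symmetric]
      by (intro exI[of _ "(alg_part w, scalar_part w)"]) simp
  qed
  then show ?thesis by (simp add: spectrum_def)
qed

text \<open>
  A self-adjoint element has real spectrum and, if it lies in the cone, no negative spectral
  values, since \<open>\<epsilon> + q\<close> is invertible for \<open>\<epsilon> > 0\<close> and \<open>q\<close> in the cone. Conversely a nonnegative
  spectrum provides exactly the inverses required by \<open>pos_coneI_invertible\<close>.
\<close>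

lemma positive_iff: "positive a \<longleftrightarrow> embed a \<in> pos_cone"
proof
  assume pos: "positive a"
  then have sa: "adj a = a" by (simp add: positive_def self_adjoint_def)
  show "embed a \<in> pos_cone"
  proof (rule pos_coneI_invertible)
    show "adj (embed a) = embed a" using sa by (simp flip: embed_simps)
    fix t :: real assume "t > 0"
    then have "- complex_of_real t \<notin> \<real>\<^sub>\<ge>\<^sub>0" by (simp add: complex_nonneg_Reals_iff)
    then have "- complex_of_real t \<notin> spectrum a" using pos by (auto simp: positive_def)
    then have "has_inverse (Unitization (- a) (- complex_of_real t))" by (simp add: in_spectrum_iff)
    then have "has_inverse ((- 1) *\<^sub>R Unitization (- a) (- complex_of_real t))"
      by (intro has_inverse_scaleR) simp_all
    also have "(- 1) *\<^sub>R Unitization (- a) (- complex_of_real t) = t *\<^sub>R 1 + embed a"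
      by (simp add: unitization_eq_iff scaleR_conv_of_real[where 'a = complex])
    finally show "has_inverse (t *\<^sub>R 1 + embed a)" .
  qed
next
  assume pos: "embed a \<in> pos_cone"
  have "adj (embed a) = embed a" by (rule pos_cone_sa[OF pos])
  then have sa: "adj a = a" by (simp flip: embed_simps)
  have "s \<in> \<real>\<^sub>\<ge>\<^sub>0" if "s \<in> spectrum a" for s
  proof (rule ccontr)
    assume s: "s \<notin> \<real>\<^sub>\<ge>\<^sub>0"
    have "has_inverse (Unitization (- a) s)"
    proof (cases "Im s = 0")
      case True
      then have "Re s < 0" using s by (simp add: complex_nonneg_Reals_iff)
      then have "has_inverse ((- 1) *\<^sub>R ((- Re s) *\<^sub>R 1 + embed a))"
        by (intro has_inverse_scaleR has_inverse_pos_cone_plus pos) simp_all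
      also have "(- 1) *\<^sub>R ((- Re s) *\<^sub>R 1 + embed a) = Unitization (- a) s"
        using True by (simp add: unitization_eq_iff complex_eq_iff)
      finally show ?thesis .
    next
      case False
      have "has_inverse ((Re s *\<^sub>R 1 - embed a) + Im s *\<^sub>R (\<i> *\<^sub>C 1))"
        using pos_cone_sa[OF pos] False by (intro has_inverse_sa_nonreal) (simp_all add: adj_diff)
      also have "(Re s *\<^sub>R 1 - embed a) + Im s *\<^sub>R (\<i> *\<^sub>C 1) = Unitization (- a) s"
        by (simp add: unitization_eq_iff complex_eq_iff)
      finally show ?thesis .
    qed
    then show False using that by (simp add: in_spectrum_iff)
  qed
  then show "positive a" using sa by (auto simp: positive_def self_adjoint_def)
qed

lemma positive_sa: "positive a \<Longrightarrow> adj a = a"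
  by (simp add: positive_def self_adjoint_def)

lemma positive_0 [simp]: "positive 0"
  by (simp add: positive_iff)

lemma positive_add: "positive a \<Longrightarrow> positive b \<Longrightarrow> positive (a + b)"
  by (simp add: positive_iff pos_cone_add)

lemma positive_scaleR: "positive a \<Longrightarrow> 0 \<le> r \<Longrightarrow> positive (r *\<^sub>R a)"
  by (simp add: positive_iff pos_cone_scaleR)

lemma positive_adj_mult_self: "positive (adj a * a)"
  by (simp add: positive_iff adj_mult_self_in_pos_cone)

lemma positive_norm_mono: "positive a \<Longrightarrow> positive (b - a) \<Longrightarrow> norm a \<le> norm b"
  using pos_cone_norm_mono[of "embed a" "embed b"] by (simp add: positive_iff)

text \<open>
  In the unitization, \<open>\<parallel>a\<parallel> - a\<close> is positive; conjugating by \<open>c\<close> brings the statement back into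
  the algebra.
\<close>

lemma positive_norm_conj:
  assumes "positive a"
  shows "positive (norm a *\<^sub>R (adj c * c) - adj c * a * c)"
proof -
  have "norm a *\<^sub>R 1 - embed a \<in> pos_cone"
    using pos_cone_sa[of "embed a"] assms
    by (intro norm_scaleR_1_minus_pos_cone) (simp_all add: positive_iff)
  from pos_cone_conj[OF this, of "embed c"] show ?thesis
    by (simp add: positive_iff algebra_simps)
qed

lemma positive_sqrt_mono:
  assumes "positive p" "positive q" "positive (q * q - p * p)"
  shows "positive (q - p)"
  using pos_cone_sqrt_mono[of "embed p" "embed q"] assms by (simp add: positive_iff)

lemma positive_sqrt_unique:
  assumes "positive p" "positive q" "p * p = q * q"
  shows "p = q"
proof -
  have "embed (q - p) \<in> pos_cone" "- embed (q - p) \<in> pos_cone"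
    using positive_sqrt_mono[of p q] positive_sqrt_mono[of q p] assms by (simp_all add: positive_iff)
  then have "embed (q - p) = 0" by (rule pos_cone_antisym)
  then show ?thesis by simp
qed

text \<open>
  The root is taken in the unitization. Its scalar part squares to \<open>0\<close>, so it already lies in
  the algebra.
\<close>

lemma positive_sqrt_exists:
  assumes "positive a"
  obtains b where "positive b" "b * b = a"
proof -
  obtain s where s: "s \<in> pos_cone" "s * s = embed a"
    using pos_cone_sqrt assms positive_iff by metis
  have "scalar_part s * scalar_part s = scalar_part (embed a)" by (simp flip: s(2))
  then have "embed (alg_part s) = s" by (simp add: unitization_eq_iff)
  then show thesis using s that[of "alg_part s"] positive_iff by (metis embed_inject embed_simps(5))
qed

lemma pos_sqrt_eqI: "positive b \<Longrightarrow> b * b = a \<Longrightarrow> pos_sqrt a = b"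
  unfolding pos_sqrt_def using positive_sqrt_unique by (intro the_equality) auto

lemma
  assumes "positive a"
  shows positive_pos_sqrt: "positive (pos_sqrt a)"
    and pos_sqrt_square: "pos_sqrt a * pos_sqrt a = a"
proof -
  obtain b where b: "positive b" "b * b = a" using positive_sqrt_exists[OF assms] by blast
  then show "positive (pos_sqrt a)" "pos_sqrt a * pos_sqrt a = a" using pos_sqrt_eqI[OF b] by simp_all
qed

lemma pos_sqrt_scaleR:
  assumes "positive a" "0 \<le> r"
  shows "pos_sqrt (r\<^sup>2 *\<^sub>R a) = r *\<^sub>R pos_sqrt a"
  using assms
  by (intro pos_sqrt_eqI positive_scaleR positive_pos_sqrt)
    (simp_all add: pos_sqrt_square power2_eq_square)

lemma cstar_le_iff: "a \<preceq> b \<longleftrightarrow> adj a = a \<and> adj b = b \<and> positive (b - a)"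
  by (simp add: cstar_le_def self_adjoint_def)

lemma cstar_le_trans: "a \<preceq> b \<Longrightarrow> b \<preceq> c \<Longrightarrow> a \<preceq> c"
  using positive_add[of "b - a" "c - b"] by (simp add: cstar_le_iff)

lemma zero_cstar_le_iff: "0 \<preceq> a \<longleftrightarrow> positive a"
  using positive_sa by (auto simp: cstar_le_iff)

lemma cstar_le_scaleR: "a \<preceq> b \<Longrightarrow> 0 \<le> r \<Longrightarrow> r *\<^sub>R a \<preceq> r *\<^sub>R b"
  using positive_scaleR[of "b - a" r] by (simp add: cstar_le_iff scaleR_diff_right)

lemma cstar_le_scaleR_left: "positive a \<Longrightarrow> r \<le> s \<Longrightarrow> r *\<^sub>R a \<preceq> s *\<^sub>R a"
  using positive_scaleR[of a "s - r"] positive_sa[of a] by (simp add: cstar_le_iff scaleR_left_diff_distrib)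

lemma pos_sqrt_mono:
  assumes "positive a" "a \<preceq> b"
  shows "pos_sqrt a \<preceq> pos_sqrt b"
proof -
  have "positive b" using positive_add[of a "b - a"] assms by (simp add: cstar_le_iff)
  then show ?thesis
    using assms positive_sqrt_mono[of "pos_sqrt a" "pos_sqrt b"]
    by (simp add: cstar_le_iff positive_pos_sqrt pos_sqrt_square positive_sa)
qed

section \<open>Inner product modules\<close>

context inner_product_module
begin

lemma ip_add_left: "ip (x + y) z = ip x z + ip y z"
  by (metis adj_add adj_ip ip_add_right)

lemma ip_act_left: "ip (x \<cdot> a) y = adj a * ip x y"
  by (metis adj_mult adj_ip ip_act_right)

lemma ip_diff_right: "ip x (y - z) = ip x y - ip x z"
  using ip_add_right[of x "y - z" z] by simp

lemma ip_diff_left: "ip (x - y) z = ip x z - ip y z"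
  using ip_add_left[of "x - y" y z] by simp

lemma act_diff_right: "x \<cdot> (a - b) = x \<cdot> a - x \<cdot> b"
  using act_add_right[of x "a - b" b] by simp

lemmas ip_expand = ip_add_left ip_add_right ip_diff_left ip_diff_right ip_act_left ip_act_right

lemma positive_ip_self: "positive (ip x x)"
  using ip_self_nonneg zero_cstar_le_iff by blast

lemma module_abs_square: "module_abs ip x * module_abs ip x = ip x x"
  by (simp add: module_abs_def pos_sqrt_square positive_ip_self)

lemma module_norm_mono: "ip x x \<preceq> ip y y \<Longrightarrow> module_norm ip x \<le> module_norm ip y"
  unfolding module_norm_def
  by (intro real_sqrt_le_mono positive_norm_mono positive_ip_self) (simp add: cstar_le_iff)

text \<open>
  As for Hilbert spaces, expand \<open>0 \<le> \<langle>v - u a / N, v - u a / N\<rangle>\<close> with \<open>a = \<langle>u,v\<rangle>\<close> and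
  \<open>N = \<parallel>\<langle>u,u\<rangle>\<parallel>\<close>. The term \<open>a\<^sup>* \<langle>u,u\<rangle> a\<close>, which cannot be pulled apart as in the scalar case,
  is at most \<open>N a\<^sup>* a\<close>.
\<close>

lemma cauchy_schwarz_square: "ip v u * ip u v \<preceq> norm (ip u u) *\<^sub>R ip v v"
proof (cases "norm (ip u u) = 0")
  case True
  then have "ip u v = 0" using ip_self_eq_0[of u] ip_diff_left[of u u v] by simp
  then show ?thesis using True by (simp add: cstar_le_iff)
next
  case False
  define N where "N = norm (ip u u)"
  have N: "N > 0" using False by (simp add: N_def)
  define a where "a = ip u v"
  have aa: "adj a = ip v u" by (simp add: a_def adj_ip)
  \<comment> \<open>the second summand is the slack in \<open>a\<^sup>* \<langle>u,u\<rangle> a \<le> N a\<^sup>* a\<close>; adding it makes the mixed terms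
    collapse to a single \<open>a\<^sup>* a\<close>\<close>
  have "positive (N *\<^sub>R ip (v - u \<cdot> ((1/N) *\<^sub>R a)) (v - u \<cdot> ((1/N) *\<^sub>R a))
      + (1/N) *\<^sub>R (N *\<^sub>R (adj a * a) - adj a * ip u u * a))"
    unfolding N_def
    by (intro positive_add positive_scaleR positive_norm_conj positive_ip_self) simp_all
  also have "N *\<^sub>R ip (v - u \<cdot> ((1/N) *\<^sub>R a)) (v - u \<cdot> ((1/N) *\<^sub>R a))
      + (1/N) *\<^sub>R (N *\<^sub>R (adj a * a) - adj a * ip u u * a) = N *\<^sub>R ip v v - adj a * a"
    using N by (simp add: ip_expand aa flip: a_def) (simp add: algebra_simps)
  finally have "positive (N *\<^sub>R ip v v - adj a * a)" .
  then show ?thesis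
    using positive_sa[OF positive_adj_mult_self[of a]] positive_sa[OF positive_ip_self[of v]]
    by (simp add: cstar_le_iff aa N_def flip: a_def)
qed

lemma cauchy_schwarz: "cstar_abs (ip u v) \<preceq> module_norm ip u *\<^sub>R module_abs ip v"
proof -
  have "cstar_abs (ip u v) \<preceq> pos_sqrt ((module_norm ip u)\<^sup>2 *\<^sub>R ip v v)"
    unfolding cstar_abs_def
    using cauchy_schwarz_square[of v u]
    by (intro pos_sqrt_mono positive_adj_mult_self) (simp add: adj_ip module_norm_def)
  also have "\<dots> = module_norm ip u *\<^sub>R module_abs ip v"
    unfolding module_abs_def
    by (intro pos_sqrt_scaleR positive_ip_self) (simp add: module_norm_def)
  finally show ?thesis .
qed

lemma act_idempotent:
  assumes "ip e e * ip e e = ip e e"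
  shows "e \<cdot> ip e e = e"
proof -
  have "ip (e \<cdot> ip e e - e) (e \<cdot> ip e e - e) = 0"
    by (simp add: ip_expand adj_ip assms mult.assoc)
  then show ?thesis using ip_self_eq_0 by fastforce
qed

text \<open>
  The vector \<open>x - e s - e\<langle>e, x - e s\<rangle>\<close> is orthogonal to \<open>e\<close> and equals \<open>x - e\<langle>e,x\<rangle>\<close>, which is
  why neither \<open>s\<close> nor \<open>t\<close> appears on the right-hand side.
\<close>

lemma ip_orthogonal_part:
  assumes "ip e e * ip e e = ip e e"
  shows "ip (x - e \<cdot> s - e \<cdot> ip e (x - e \<cdot> s)) (y - e \<cdot> t) = ip x y - ip x e * ip e y"
proof -
  have r: "ip z e * ip e e = ip z e" for z
    using act_idempotent[OF assms] ip_act_right[of z e "ip e e"] by simp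
  have l: "ip e e * ip e z = ip e z" for z
    using act_idempotent[OF assms] ip_act_left[of e "ip e e" z] by (simp add: adj_ip)
  have r': "ip z e * (ip e e * w) = ip z e * w" for z w using r[of z] by (simp flip: mult.assoc)
  show ?thesis
    by (simp add: ip_expand adj_diff adj_mult adj_ip algebra_simps r l r')
qed

lemma ip_orthogonal_part_le:
  assumes "ip e e * ip e e = ip e e"
  shows "ip (x - e \<cdot> ip e x) (x - e \<cdot> ip e x) \<preceq> ip x x"
proof -
  have l: "ip e e * ip e z = ip e z" for z
    using act_idempotent[OF assms] ip_act_left[of e "ip e e" z] by (simp add: adj_ip)
  have "ip x x - ip (x - e \<cdot> ip e x) (x - e \<cdot> ip e x) = adj (ip e x) * ip e x"
    by (simp add: ip_expand adj_ip algebra_simps l)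
  then show ?thesis
    using positive_adj_mult_self[of "ip e x"] positive_sa[OF positive_ip_self] by (simp add: cstar_le_iff)
qed

lemma covariance_le:
  assumes "ip e e * ip e e = ip e e"
  shows "cstar_abs (ip x y - ip x e * ip e y) \<preceq>
    module_norm ip (x - e \<cdot> s) *\<^sub>R module_abs ip (y - e \<cdot> t)"
proof -
  let ?u = "x - e \<cdot> s - e \<cdot> ip e (x - e \<cdot> s)"
  have "cstar_abs (ip ?u (y - e \<cdot> t)) \<preceq> module_norm ip ?u *\<^sub>R module_abs ip (y - e \<cdot> t)"
    by (rule cauchy_schwarz)
  moreover have "module_norm ip ?u *\<^sub>R module_abs ip (y - e \<cdot> t) \<preceq>
      module_norm ip (x - e \<cdot> s) *\<^sub>R module_abs ip (y - e \<cdot> t)"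
    unfolding module_abs_def
    by (intro cstar_le_scaleR_left positive_pos_sqrt positive_ip_self module_norm_mono
        ip_orthogonal_part_le assms)
  ultimately show ?thesis
    unfolding ip_orthogonal_part[OF assms] by (rule cstar_le_trans)
qed

text \<open>
  For \<open>u = x - e a\<close> and \<open>v = x - e b\<close> the midpoint difference is \<open>(u + v) / 2\<close>, and
  \<open>\<langle>u + v, u + v\<rangle> = \<langle>v - u, v - u\<rangle> + 4 Re \<langle>u, v\<rangle>\<close>.
\<close>

lemma ip_midpoint:
  "ip (x - e \<cdot> ((1/2) *\<^sub>R (a + b))) (x - e \<cdot> ((1/2) *\<^sub>R (a + b))) =
    (1/4) *\<^sub>R ip (e \<cdot> (a - b)) (e \<cdot> (a - b)) - real_part (ip (x - e \<cdot> a) (e \<cdot> b - x))"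
proof -
  define u v where "u = x - e \<cdot> a" and "v = x - e \<cdot> b"
  define w where "w = x - e \<cdot> ((1/2) *\<^sub>R (a + b))"
  have half: "e \<cdot> ((1/2) *\<^sub>R (a + b)) + e \<cdot> ((1/2) *\<^sub>R (a + b)) = e \<cdot> a + e \<cdot> b"
    by (simp flip: act_add_right scaleR_2 add: scaleR_scaleR)
  have "w + w = u + v" unfolding w_def u_def v_def using half by (simp add: algebra_simps)
  then have "ip (w + w) (w + w) = ip (u + v) (u + v)" by simp
  then have "4 *\<^sub>R ip w w = ip (u + v) (u + v)"
    by (simp add: ip_add_left ip_add_right flip: scaleR_2)
  then have "(1/4) *\<^sub>R 4 *\<^sub>R ip w w = (1/4) *\<^sub>R ip (u + v) (u + v)" by (rule arg_cong)
  then have "ip w w = (1/4) *\<^sub>R ip (u + v) (u + v)" by simp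
  also have "\<dots> = (1/4) *\<^sub>R ip (v - u) (v - u) - real_part (ip u (- v))"
  proof -
    have "ip u (- v) = - ip u v"
      using ip_add_right[of u v "- v"] ip_diff_right[of u 0 0]
      by (simp add: eq_neg_iff_add_eq_0 add.commute)
    moreover have "(1/4) *\<^sub>R z + ((1/4) *\<^sub>R z + w) = (1/2) *\<^sub>R z + w"
      "(1/4) *\<^sub>R z + (1/4) *\<^sub>R z = (1/2) *\<^sub>R z" for z w :: 'a
      by (simp_all flip: scaleR_left_distrib add.assoc)
    ultimately show ?thesis by (simp add: real_part_def ip_expand adj_ip algebra_simps)
  qed
  also have "v - u = e \<cdot> (a - b)" by (simp add: u_def v_def act_diff_right)
  also have "- v = e \<cdot> b - x" by (simp add: v_def)
  finally show ?thesis unfolding w_def u_def .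
qed

lemma ip_midpoint_le:
  assumes "0 \<preceq> real_part (ip (x - e \<cdot> a) (e \<cdot> b - x))"
  shows "ip (x - e \<cdot> ((1/2) *\<^sub>R (a + b))) (x - e \<cdot> ((1/2) *\<^sub>R (a + b))) \<preceq>
    (1/2)\<^sup>2 *\<^sub>R ip (e \<cdot> (a - b)) (e \<cdot> (a - b))"
  using assms positive_sa[OF positive_ip_self] positive_sa[of "real_part _"]
  unfolding cstar_le_iff zero_cstar_le_iff
  by (simp add: ip_midpoint adj_diff power2_eq_square)

end

section \<open>The Gruess type inequality\<close>

theorem theorem3:
  fixes smul :: "complex \<Rightarrow> 'x::ab_group_add \<Rightarrow> 'x"
    and act :: "'x \<Rightarrow> 'a::cstar_algebra \<Rightarrow> 'x"  (infixl "\<cdot>" 70)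
    and ip :: "'x \<Rightarrow> 'x \<Rightarrow> 'a"
    and x y e :: 'x
    and a b c d :: 'a
  assumes "inner_product_module smul act ip"
    and "ip e e * ip e e = ip e e"
  shows "cstar_abs (ip x y - ip x e * ip e y) \<preceq>
           module_norm ip (x - e \<cdot> ((1/2) *\<^sub>R (a + b))) *\<^sub>R
             module_abs ip (y - e \<cdot> ((1/2) *\<^sub>R (c + d)))
       \<and> module_norm ip (x - e \<cdot> ((1/2) *\<^sub>R (a + b))) *\<^sub>R
             module_abs ip (y - e \<cdot> ((1/2) *\<^sub>R (c + d))) =
           sqrt (norm ((1/4) *\<^sub>R (module_abs ip (e \<cdot> (a - b)) * module_abs ip (e \<cdot> (a - b)))
                         - real_part (ip (x - e \<cdot> a) (e \<cdot> b - x)))) *\<^sub>R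
             pos_sqrt ((1/4) *\<^sub>R (module_abs ip (e \<cdot> (c - d)) * module_abs ip (e \<cdot> (c - d)))
                         - real_part (ip (y - e \<cdot> c) (e \<cdot> d - y)))
       \<and> (0 \<preceq> real_part (ip (x - e \<cdot> a) (e \<cdot> b - x)) \<and>
           0 \<preceq> real_part (ip (y - e \<cdot> c) (e \<cdot> d - y)) \<longrightarrow>
          cstar_abs (ip x y - ip x e * ip e y) \<preceq>
            (1/4 * module_norm ip (e \<cdot> (a - b))) *\<^sub>R module_abs ip (e \<cdot> (c - d)))"
proof -
  interpret inner_product_module smul act ip by (rule assms(1))
  let ?x = "x - e \<cdot> ((1/2) *\<^sub>R (a + b))" and ?y = "y - e \<cdot> ((1/2) *\<^sub>R (c + d))"
  have bound: "cstar_abs (ip x y - ip x e * ip e y) \<preceq> module_norm ip ?x *\<^sub>R module_abs ip ?y"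
    by (rule covariance_le[OF assms(2)])
  have "cstar_abs (ip x y - ip x e * ip e y) \<preceq>
      (1/4 * module_norm ip (e \<cdot> (a - b))) *\<^sub>R module_abs ip (e \<cdot> (c - d))"
    if x: "0 \<preceq> real_part (ip (x - e \<cdot> a) (e \<cdot> b - x))"
      and y: "0 \<preceq> real_part (ip (y - e \<cdot> c) (e \<cdot> d - y))"
  proof -
    have "module_norm ip ?x \<le> sqrt (norm ((1/2)\<^sup>2 *\<^sub>R ip (e \<cdot> (a - b)) (e \<cdot> (a - b))))"
      unfolding module_norm_def using ip_midpoint_le[OF x]
      by (intro real_sqrt_le_mono positive_norm_mono positive_ip_self) (simp add: cstar_le_iff)
    also have "\<dots> = 1/2 * module_norm ip (e \<cdot> (a - b))"
      by (simp add: module_norm_def real_sqrt_mult real_sqrt_divide)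
    finally have nx: "module_norm ip ?x \<le> 1/2 * module_norm ip (e \<cdot> (a - b))" .
    have "module_abs ip ?y \<preceq> pos_sqrt ((1/2)\<^sup>2 *\<^sub>R ip (e \<cdot> (c - d)) (e \<cdot> (c - d)))"
      unfolding module_abs_def by (intro pos_sqrt_mono positive_ip_self ip_midpoint_le y)
    also have "\<dots> = (1/2) *\<^sub>R module_abs ip (e \<cdot> (c - d))"
      unfolding module_abs_def by (intro pos_sqrt_scaleR positive_ip_self) simp
    finally have ay: "module_abs ip ?y \<preceq> (1/2) *\<^sub>R module_abs ip (e \<cdot> (c - d))" .
    have "module_norm ip ?x *\<^sub>R module_abs ip ?y \<preceq>
        (1/2 * module_norm ip (e \<cdot> (a - b))) *\<^sub>R module_abs ip ?y"
      using nx unfolding module_abs_def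
      by (intro cstar_le_scaleR_left positive_pos_sqrt positive_ip_self)
    moreover have "(1/2 * module_norm ip (e \<cdot> (a - b))) *\<^sub>R module_abs ip ?y \<preceq>
        (1/2 * module_norm ip (e \<cdot> (a - b))) *\<^sub>R (1/2) *\<^sub>R module_abs ip (e \<cdot> (c - d))"
      by (intro cstar_le_scaleR ay) (simp add: module_norm_def)
    ultimately have "cstar_abs (ip x y - ip x e * ip e y) \<preceq>
        (1/2 * module_norm ip (e \<cdot> (a - b))) *\<^sub>R (1/2) *\<^sub>R module_abs ip (e \<cdot> (c - d))"
      using bound cstar_le_trans by blast
    then show ?thesis by simp
  qed
  moreover have "module_norm ip ?x = sqrt (norm ((1/4) *\<^sub>R (module_abs ip (e \<cdot> (a - b)) *
      module_abs ip (e \<cdot> (a - b))) - real_part (ip (x - e \<cdot> a) (e \<cdot> b - x))))"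
    unfolding module_norm_def module_abs_square ip_midpoint ..
  moreover have "module_abs ip ?y = pos_sqrt ((1/4) *\<^sub>R (module_abs ip (e \<cdot> (c - d)) *
      module_abs ip (e \<cdot> (c - d))) - real_part (ip (y - e \<cdot> c) (e \<cdot> d - y)))"
    unfolding module_abs_square unfolding module_abs_def ip_midpoint ..
  ultimately show ?thesis using bound by simp
qed

end
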